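(* If $y\in\mathcal{F}_{\mathbb{Z}}$ and $(p,q)\in\mathrm{Cyc}_{\mathbb{Z}}(y)$, then $$\sum_{z\in\hat\Psi^-(y,p)}|\hat{\mathcal{R}}_{\mathtt{FPF}}(z)|=\sum_{z\in\hat\Psi^+(y,q)}|\hat{\mathcal{R}}_{\mathtt{FPF}}(z)|.$$
   Context: $S_{\mathbb{Z}}$ is the group of permutations of $\mathbb{Z}$ fixing all but finitely many integers; $(i,j)$ denotes a transposition; $s_i=(i,i+1)$; $\ell(w)$ is the number of pairs $i<j$ with $w(i)>w(j)$. A reduced word for $w$ is a sequence $(s_{i_1},\dots,s_{i_k})$ with $w=s_{i_1}\cdots s_{i_k}$ and $k=\ell(w)$. Let $\Theta:\mathbb{Z}\to\mathbb{Z}$, $\Theta(i)=i-(-1)^i$, and let $\mathcal{F}_{\mathbb{Z}}=\{w^{-1}\Theta w:w\in S_{\mathbb{Z}}\}$. For $z\in\mathcal{F}_{\mathbb{Z}}$: $\mathrm{Inv}(z)=\{(i,j)\in\mathbb{Z}\times\mathbb{Z}:i<j,\ z(i)>z(j)\}$, $\mathrm{Cyc}_{\mathbb{Z}}(z)=\{(i,j)\in\mathbb{Z}\times\mathbb{Z}:i\le j=z(i)\}$, $\hat\ell_{\mathtt{FPF}}(z)=\frac12|\mathrm{Inv}(z)-\mathrm{Cyc}_{\mathbb{Z}}(z)|$ (a finite nonnegative integer). The Bruhat order $<$ on $\mathcal{F}_{\mathbb{Z}}$ is the weakest partial order with $z<tzt$ whenever $t\in S_{\mathbb{Z}}$ is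 a transposition with $\hat\ell_{\mathtt{FPF}}(z)<\hat\ell_{\mathtt{FPF}}(tzt)$; $y\lessdot_{\mathcal{F}}z$ means $\{y\}=\{w\in\mathcal{F}_{\mathbb{Z}}:y\le w<z\}$. For $y\in\mathcal{F}_{\mathbb{Z}}$, $r\in\mathbb{Z}$: $\hat\Psi^+(y,r)=\{z\in\mathcal{F}_{\mathbb{Z}}:y\lessdot_{\mathcal{F}}z$ and $z=(r,j)y(r,j)$ for an integer $j>r\}$, $\hat\Psi^-(y,r)=\{z\in\mathcal{F}_{\mathbb{Z}}:y\lessdot_{\mathcal{F}}z$ and $z=(i,r)y(i,r)$ for an integer $i<r\}$. $\mathcal{A}_{\mathtt{FPF}}(z)$ is the set of $w\in S_{\mathbb{Z}}$ of minimal length with $z=w^{-1}\Theta w$, and $\hat{\mathcal{R}}_{\mathtt{FPF}}(z)$ is the set of all reduced words of all elements of $\mathcal{A}_{\mathtt{FPF}}(z)$. *)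

theory Defs
  imports Complex_Main "HOL-Combinatorics.Transposition"
begin

definition S_Z :: "(int \<Rightarrow> int) set" where
  "S_Z = {w. bij w \<and> finite {i. w i \<noteq> i}}"

definition Inv :: "(int \<Rightarrow> int) \<Rightarrow> (int \<times> int) set" where
  "Inv w = {(i, j). i < j \<and> w i > w j}"

definition len :: "(int \<Rightarrow> int) \<Rightarrow> nat" where
  "len w = card (Inv w)"

definition simple_refl :: "int \<Rightarrow> int \<Rightarrow> int" where
  "simple_refl i = transpose i (i + 1)"

text \<open>Permutations act on the left, so the product of a word is the composition of its
  letters, with the last letter applied first.\<close>

definition reduced_words :: "(int \<Rightarrow> int) \<Rightarrow> (int \<Rightarrow> int) list set" where
  "reduced_words w =
     {a. set a \<subseteq> range simple_refl \<and> foldr (\<circ>) a id = w \<and> length a = len w}"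

text \<open>The exponent \<open>\<bar>i\<bar>\<close> only serves to make \<open>(-1)\<^sup>i\<close> meaningful for negative \<open>i\<close>.\<close>

definition Theta :: "int \<Rightarrow> int" where
  "Theta i = i - (- 1) ^ nat \<bar>i\<bar>"

definition F_Z :: "(int \<Rightarrow> int) set" where
  "F_Z = {inv w \<circ> Theta \<circ> w | w. w \<in> S_Z}"

definition Cyc :: "(int \<Rightarrow> int) \<Rightarrow> (int \<times> int) set" where
  "Cyc z = {(i, j). i \<le> j \<and> j = z i}"

definition len_FPF :: "(int \<Rightarrow> int) \<Rightarrow> rat" where
  "len_FPF z = of_nat (card (Inv z - Cyc z)) / 2"

definition conj_transp :: "int \<Rightarrow> int \<Rightarrow> (int \<Rightarrow> int) \<Rightarrow> int \<Rightarrow> int" where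
  "conj_transp i j z = transpose i j \<circ> z \<circ> transpose i j"

text \<open>The weakest partial order containing a given set of relations is the intersection of all
  partial orders containing it.  The requirement \<open>z < t z t\<close> is imposed in its non-strict form,
  since \<open>z \<noteq> t z t\<close> already follows from \<open>len_FPF z < len_FPF (t z t)\<close>.\<close>

definition bruhat_F :: "((int \<Rightarrow> int) \<times> (int \<Rightarrow> int)) set" where
  "bruhat_F = \<Inter> {r. partial_order_on F_Z r \<and>
     (\<forall>z\<in>F_Z. \<forall>i j. i \<noteq> j \<longrightarrow> len_FPF z < len_FPF (conj_transp i j z)
        \<longrightarrow> (z, conj_transp i j z) \<in> r)}"

definition covers_F :: "(int \<Rightarrow> int) \<Rightarrow> (int \<Rightarrow> int) \<Rightarrow> bool" where
  "covers_F y z \<longleftrightarrow>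
     {y} = {w \<in> F_Z. (y, w) \<in> bruhat_F \<and> (w, z) \<in> bruhat_F \<and> w \<noteq> z}"

definition Psi_plus :: "(int \<Rightarrow> int) \<Rightarrow> int \<Rightarrow> (int \<Rightarrow> int) set" where
  "Psi_plus y r = {z \<in> F_Z. covers_F y z \<and> (\<exists>j>r. z = conj_transp r j y)}"

definition Psi_minus :: "(int \<Rightarrow> int) \<Rightarrow> int \<Rightarrow> (int \<Rightarrow> int) set" where
  "Psi_minus y r = {z \<in> F_Z. covers_F y z \<and> (\<exists>i<r. z = conj_transp i r y)}"

definition atoms_FPF :: "(int \<Rightarrow> int) \<Rightarrow> (int \<Rightarrow> int) set" where
  "atoms_FPF z = {w \<in> S_Z. z = inv w \<circ> Theta \<circ> w \<and>
     (\<forall>v\<in>S_Z. z = inv v \<circ> Theta \<circ> v \<longrightarrow> len w \<le> len v)}"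

definition words_FPF :: "(int \<Rightarrow> int) \<Rightarrow> (int \<Rightarrow> int) list set" where
  "words_FPF z = (\<Union>w\<in>atoms_FPF z. reduced_words w)"

end

theory Submission imports Defs begin

text \<open>
  Let \<open>R z\<close> be the number of words of \<open>z\<close>, let \<open>(p, q)\<close> be a cycle of \<open>y\<close>, and
  let \<open>D(y)\<close> be the sum of \<open>R\<close> over the upper covers of \<open>y\<close> that move \<open>q\<close> to the right minus the sum of
  \<open>R\<close> over those that move \<open>p\<close> to the left.  The claim is \<open>D(y) = 0\<close>.  The model is the expansion of
  \<open>(x\<^sub>p + x\<^sub>q) S\<^sub>y\<close> in the fixed-point-free involution Schubert polynomials \<open>S\<^sub>z\<close>, whose coefficients
  are the signs in \<open>D(y)\<close>.  The divided difference \<open>\<partial>\<^sub>i\<close> sends \<open>S\<^sub>z\<close> to \<open>S\<close> of \<open>s\<^sub>i z s\<^sub>i\<close> if \<open>i\<close>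
  is a descent of \<open>z\<close> not coming from a cycle \<open>(i, i + 1)\<close>, and to \<open>0\<close> otherwise.  By the Leibniz rule, \<open>\<partial>\<^sub>i\<close> of
  \<open>(x\<^sub>p + x\<^sub>q) S\<^sub>y\<close> is \<open>s\<^sub>i(x\<^sub>p + x\<^sub>q) \<partial>\<^sub>i S\<^sub>y\<close> plus \<open>\<partial>\<^sub>i(x\<^sub>p + x\<^sub>q) S\<^sub>y\<close>, and the integers
  \<open>\<partial>\<^sub>i(x\<^sub>p + x\<^sub>q)\<close> add up to \<open>0\<close> over all \<open>i\<close>.  As the last letter of a word of \<open>z\<close> runs through
  the descents of \<open>z\<close>, the function \<open>R\<close> satisfies \<open>R(z) = \<Sum>\<^sub>i R(s\<^sub>i z s\<^sub>i)\<close>.  So \<open>D(y)\<close> is the sum of the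
  numbers \<open>D(s\<^sub>i y s\<^sub>i)\<close> over the descents \<open>i\<close> of \<open>y\<close>, taken at the cycles that \<open>s\<^sub>i\<close> makes out of
  \<open>(p, q)\<close>, and induction on the length finishes the proof.

  Read off coefficient by coefficient, the Leibniz rule is a statement about covers and descents, and in this
  form it holds separately for the two kinds of covers.  For one kind it is \<open>leibniz_up_covers\<close>, whose proof compares the covers of \<open>y\<close> with those of \<open>s\<^sub>i y s\<^sub>i\<close>; the reflection
  \<open>u \<mapsto> 1 - u\<close> of the integers turns it into \<open>leibniz_down_covers\<close>.  The induction is
  \<open>sum_up_covers_eq_sum_down_covers\<close>.

  Two inputs connect this with the definitions.  An inversion count gives the effect
  of conjugation by a transposition on the length (\<open>strict_inv_conj_transp\<close>), and from it the covers of the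
  Bruhat order that are conjugates by a transposition are the pairs of lengths differing by one, with an
  explicit description (\<open>strict_inv_cover_pair\<close>, \<open>covers_F_conj_transp_iff\<close>).  And the reduced words of
  the atoms of \<open>z\<close> are precisely the shortest words leading from \<open>\<Theta>\<close> to \<open>z\<close> by successive conjugation
  (\<open>words_FPF_eq\<close>), which yields the recurrence for \<open>R\<close> (\<open>card_words_FPF_rec\<close>).
\<close>

section \<open>Inversions inside a finite window\<close>

text \<open>
  An element of \<open>F_Z\<close> has infinitely many inversions, nearly all of them cycles of \<open>\<Theta>\<close>.  Counting inside a
  finite set makes lengths comparable.
\<close>

definition inversions_in :: "int set \<Rightarrow> (int \<Rightarrow> int) \<Rightarrow> nat" where
  "inversions_in W w = card (Inv w \<inter> W \<times> W)"

lemma inversions_in_sum: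
  assumes "finite W"
  shows "inversions_in W w = (\<Sum>u\<in>W. \<Sum>v\<in>W. of_bool (u < v \<and> w v < w u))"
proof -
  have "(\<Sum>u\<in>W. \<Sum>v\<in>W. of_bool (u < v \<and> w v < w u)) =
      (\<Sum>x\<in>W \<times> W. of_bool (fst x < snd x \<and> w (snd x) < w (fst x)) :: nat)"
    by (simp add: sum.cartesian_product case_prod_beta)
  also have "\<dots> = card {x \<in> W \<times> W. fst x < snd x \<and> w (snd x) < w (fst x)}"
    using assms by (simp add: Collect_conj_eq Int_commute)
  also have "{x \<in> W \<times> W. fst x < snd x \<and> w (snd x) < w (fst x)} = Inv w \<inter> W \<times> W"
    by (auto simp: Inv_def)
  finally show ?thesis by (simp add: inversions_in_def)
qed

text \<open>
  Only pairs that meet \<open>{a, b}\<close> change status.  The pair \<open>(a, b)\<close> becomes an inversion, and the two pairs formed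
  by \<open>e\<close> with \<open>a\<close> and with \<open>b\<close> contain as many inversions before as after, except when \<open>e\<close> lies between \<open>a\<close>
  and \<open>b\<close> both in position and in value.
\<close>

lemma inversions_in_transpose:
  assumes "finite W" "a \<in> W" "b \<in> W" "a < b" "w a < w b" "inj w"
  shows "inversions_in W (w \<circ> transpose a b) =
    inversions_in W w + 1 + 2 * card {e \<in> W. a < e \<and> e < b \<and> w a < w e \<and> w e < w b}"
proof -
  define V where "V = W - {a, b}"
  have W: "W = insert a (insert b V)" and V: "finite V" "a \<notin> V" "b \<notin> V" "a \<noteq> b"
    using assms by (auto simp: V_def)
  define I :: "(int \<Rightarrow> int) \<Rightarrow> int \<Rightarrow> int \<Rightarrow> nat"
    where "I w u v = of_bool (u < v \<and> w v < w u)" for w u v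
  have split: "inversions_in W g = I g a b + I g b a +
      (\<Sum>u\<in>V. I g u a + I g u b + I g a u + I g b u) + (\<Sum>u\<in>V. \<Sum>v\<in>V. I g u v)" for g
  proof -
    have "I g a a = 0" "I g b b = 0" by (auto simp: I_def)
    moreover have "inversions_in W g = (\<Sum>u\<in>W. \<Sum>v\<in>W. I g u v)"
      using assms(1) by (simp add: inversions_in_sum I_def)
    ultimately show ?thesis
      using V by (simp add: W sum.distrib)
  qed
  let ?v = "w \<circ> transpose a b"
  have 1: "I ?v u v = I w u v" if "u \<in> V" "v \<in> V" for u v
    using that V by (auto simp: I_def transpose_def)
  have 2: "I ?v u a + I ?v u b + I ?v a u + I ?v b u =
      I w u a + I w u b + I w a u + I w b u +
      2 * of_bool (a < u \<and> u < b \<and> w a < w u \<and> w u < w b)" if "u \<in> V" for u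
  proof -
    have "u \<noteq> a" "u \<noteq> b" using that V by auto
    moreover have "w u \<noteq> w a" "w u \<noteq> w b"
      using calculation assms(6) by (auto dest: injD)
    ultimately show ?thesis
      using assms(4,5) by (auto simp: I_def transpose_def)
  qed
  have 3: "{e \<in> W. a < e \<and> e < b \<and> w a < w e \<and> w e < w b} =
      V \<inter> {u. a < u \<and> u < b \<and> w a < w u \<and> w u < w b}"
    by (auto simp: V_def)
  show ?thesis
    unfolding split 3
    using 1 2 V assms(4,5) by (simp add: sum.distrib I_def[of _ a b] I_def[of _ b a] flip: sum_distrib_left)
qed

lemma inversions_in_inverse:
  assumes "\<And>u. g (h u) = u" "\<And>u. h (g u) = u" "\<And>u. u \<in> W \<Longrightarrow> g u \<in> W" "\<And>u. u \<in> W \<Longrightarrow> h u \<in> W"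
  shows "inversions_in W h = inversions_in W g"
  unfolding inversions_in_def
  by (rule bij_betw_same_card[of "\<lambda>(u, v). (h v, h u)"],
      rule bij_betw_byWitness[where f' = "\<lambda>(u, v). (g v, g u)"])
     (use assms in \<open>auto simp: Inv_def\<close>)

section \<open>Fixed-point-free involutions\<close>

definition fpf :: "(int \<Rightarrow> int) \<Rightarrow> bool" where
  "fpf y \<longleftrightarrow> (\<forall>u. y (y u) = u) \<and> (\<forall>u. y u \<noteq> u)"

text \<open>
  The end points are chosen so that \<open>\<Theta>\<close> maps the window to itself.
\<close>

definition window :: "nat \<Rightarrow> int set" where
  "window n = {1 - 2 * int n .. 2 * int n}"

definition standard_outside :: "nat \<Rightarrow> (int \<Rightarrow> int) \<Rightarrow> bool" where
  "standard_outside n y \<longleftrightarrow> (\<forall>u. u \<notin> window n \<longrightarrow> y u = Theta u)"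

lemma Theta_even: "even u \<Longrightarrow> Theta u = u - 1"
  and Theta_odd: "odd u \<Longrightarrow> Theta u = u + 1"
  by (auto simp: Theta_def even_nat_iff)

lemma Theta_cases: "even u \<and> Theta u = u - 1 \<or> odd u \<and> Theta u = u + 1"
  using Theta_even Theta_odd by blast

lemma fpf_Theta: "fpf Theta"
  unfolding fpf_def using Theta_cases by (metis Theta_even Theta_odd add_diff_cancel_right' diff_add_cancel even_add
      even_diff odd_one less_irrefl zless_add1_eq add.commute diff_eq_eq)

lemma Theta_window: "Theta u \<in> window n \<longleftrightarrow> u \<in> window n"
  using Theta_cases[of u] by (auto simp: window_def) presburger+

lemma conj_transp_apply: "conj_transp a b y u = transpose a b (y (transpose a b u))"
  by (simp add: conj_transp_def)

lemma conj_transp_commute: "conj_transp a b = conj_transp b a"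
  by (auto simp: conj_transp_def transpose_commute fun_eq_iff)

lemma conj_transp_invol [simp]: "conj_transp a b (conj_transp a b y) = y"
  by (auto simp: conj_transp_def fun_eq_iff)

lemma fpf_conj_transp: "fpf y \<Longrightarrow> fpf (conj_transp a b y)"
  by (auto simp: fpf_def conj_transp_apply) (metis transpose_involutory)

lemma S_Z_bound:
  assumes "w \<in> S_Z" shows "\<exists>m. \<forall>u. m < \<bar>u\<bar> \<longrightarrow> w u = u"
proof -
  have "finite (abs ` {u. w u \<noteq> u})" using assms by (auto simp: S_Z_def)
  then obtain m where "\<forall>u\<in>abs ` {u. w u \<noteq> u}. u \<le> m"
    by (meson bdd_above.unfold bdd_above_finite)
  then show ?thesis by (intro exI[of _ m]) force
qed

lemma S_Z_transpose: "w \<in> S_Z \<Longrightarrow> w \<circ> transpose a b \<in> S_Z"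
proof -
  assume w: "w \<in> S_Z"
  have "{i. (w \<circ> transpose a b) i \<noteq> i} \<subseteq> {i. w i \<noteq> i} \<union> {a, b}"
    by (auto simp: transpose_def split: if_splits)
  then show ?thesis using w by (auto simp: S_Z_def bij_comp intro: finite_subset)
qed

lemma inv_comp_transpose:
  "bij w \<Longrightarrow> inv (w \<circ> transpose a b) = transpose a b \<circ> inv w"
  by (simp add: o_inv_distrib)

lemma F_Z_conj_transp:
  assumes "y \<in> F_Z" shows "conj_transp a b y \<in> F_Z"
proof -
  obtain w where w: "w \<in> S_Z" "y = inv w \<circ> Theta \<circ> w" using assms by (auto simp: F_Z_def)
  then have "conj_transp a b y = inv (w \<circ> transpose a b) \<circ> Theta \<circ> (w \<circ> transpose a b)"
    by (simp add: inv_comp_transpose S_Z_def conj_transp_def comp_assoc)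
  then show ?thesis using S_Z_transpose[OF w(1)] by (auto simp: F_Z_def)
qed

lemma Theta_in_F_Z: "Theta \<in> F_Z"
  unfolding F_Z_def S_Z_def by (auto intro!: exI[of _ id])

lemma F_Z_fpf: "y \<in> F_Z \<Longrightarrow> fpf y"
  using fpf_Theta by (auto simp: F_Z_def S_Z_def fpf_def bij_is_surj bij_is_inj surj_f_inv_f inv_f_f)
     (metis bij_is_surj surj_f_inv_f)

lemma F_Z_standard_outside:
  assumes "y \<in> F_Z" shows "\<exists>n. \<forall>k\<ge>n. standard_outside k y"
proof -
  obtain w where w: "w \<in> S_Z" "y = inv w \<circ> Theta \<circ> w" using assms by (auto simp: F_Z_def)
  obtain m where m: "\<And>u. m < \<bar>u\<bar> \<Longrightarrow> w u = u" using S_Z_bound[OF w(1)] by blast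
  have inv: "inv w u = u" if "m < \<bar>u\<bar>" for u
    using m[OF that] w(1) by (metis (mono_tags, lifting) S_Z_def bij_inv_eq_iff mem_Collect_eq)
  have "y u = Theta u" if "m + 1 < \<bar>u\<bar>" for u
    using that w(2) m[of u] inv[of "Theta u"] Theta_cases[of u] by auto
  moreover have "m + 1 < \<bar>u\<bar>" if "u \<notin> window k" "nat (m + 2) \<le> k" for u k
    using that by (auto simp: window_def)
  ultimately show ?thesis by (intro exI[of _ "nat (m + 2)"]) (auto simp: standard_outside_def)
qed

lemma F_Z_window:
  assumes "y \<in> F_Z"
  obtains n where "standard_outside n y" "a \<in> window n" "b \<in> window n"
proof -
  obtain n where n: "\<And>k. k \<ge> n \<Longrightarrow> standard_outside k y"
    using F_Z_standard_outside[OF assms] by blast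
  define k where "k = n + nat \<bar>a\<bar> + nat \<bar>b\<bar> + 1"
  have "standard_outside k y" "a \<in> window k" "b \<in> window k"
    using n[of k] by (auto simp: k_def window_def)
  then show ?thesis by (rule that)
qed

lemma standard_outside_maps:
  assumes "fpf y" "standard_outside n y" shows "y u \<in> window n \<longleftrightarrow> u \<in> window n"
  using assms Theta_window unfolding fpf_def standard_outside_def by metis

lemma standard_outside_conj_transp:
  "standard_outside n y \<Longrightarrow> a \<in> window n \<Longrightarrow> b \<in> window n \<Longrightarrow> standard_outside n (conj_transp a b y)"
  using Theta_window unfolding standard_outside_def conj_transp_apply
  by (metis transpose_apply_other)

text \<open>
  This is twice the length \<open>len_FPF\<close>, as a natural number.
\<close>

definition strict_inv :: "(int \<Rightarrow> int) \<Rightarrow> nat" where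
  "strict_inv y = card (Inv y - Cyc y)"

text \<open>
  Outside the window every inversion of \<open>y\<close> is a cycle, and inside it the cycles form a perfect matching of
  the \<open>4 n\<close> points.  The correction term thus depends on the window alone, so that differences of
  \<open>strict_inv\<close> are differences of inversion counts.
\<close>

lemma strict_inv_window:
  assumes y: "fpf y" and n: "standard_outside n y"
  shows "inversions_in (window n) y = strict_inv y + 2 * n" "finite (Inv y - Cyc y)"
proof -
  let ?W = "window n"
  have fin: "finite ?W" and cardW: "card ?W = 4 * n" by (auto simp: window_def)
  have yW: "y u \<in> ?W \<longleftrightarrow> u \<in> ?W" for u using standard_outside_maps[OF y n] .
  have sub: "Inv y - Cyc y \<subseteq> ?W \<times> ?W"
  proof (rule subsetI)
    fix x assume "x \<in> Inv y - Cyc y"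
    then obtain u v where x: "x = (u, v)" "u < v" "y v < y u" "v \<noteq> y u"
      by (cases x) (auto simp: Inv_def Cyc_def)
    have out: "y a = Theta a" if "a \<notin> ?W" for a using n that by (auto simp: standard_outside_def)
    have "u \<in> ?W \<and> v \<in> ?W"
    proof (rule ccontr)
      assume asm: "\<not> (u \<in> ?W \<and> v \<in> ?W)"
      consider "u \<in> ?W" "v \<notin> ?W" | "u \<notin> ?W" "v \<in> ?W" | "u \<notin> ?W" "v \<notin> ?W" using asm by blast
      then show False
      proof cases
        case 1
        then have "y u \<in> ?W" "y v \<notin> ?W" using yW by auto
        then show False using 1 x out[of v] Theta_cases[of v] by (auto simp: window_def)
      next
        case 2
        then have "y u \<notin> ?W" "y v \<in> ?W" using yW by auto
        then show False using 2 x out[of u] Theta_cases[of u] by (auto simp: window_def)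
      next
        case 3
        then show False using x out[of u] out[of v] Theta_cases[of u] Theta_cases[of v]
          by auto
      qed
    qed
    then show "x \<in> ?W \<times> ?W" using x by auto
  qed
  then show "finite (Inv y - Cyc y)" using fin finite_subset by blast
  let ?L = "{u \<in> ?W. u < y u}" and ?R = "{u \<in> ?W. y u < u}"
  have "bij_betw y ?L ?R"
    by (rule bij_betw_byWitness[where f' = y]) (use y yW in \<open>auto simp: fpf_def\<close>)
  then have "card ?L = card ?R" by (rule bij_betw_same_card)
  moreover have "?W = ?L \<union> ?R" using y by (auto simp: fpf_def) (metis linorder_neqE)
  moreover have "card (?L \<union> ?R) = card ?L + card ?R" using fin by (intro card_Un_disjoint) auto
  ultimately have L: "card ?L = 2 * n" using cardW by simp
  have "Inv y \<inter> ?W \<times> ?W = (Inv y - Cyc y) \<union> (\<lambda>u. (u, y u)) ` ?L"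
    using sub y yW by (auto simp: Inv_def Cyc_def fpf_def)
  moreover have "(Inv y - Cyc y) \<inter> (\<lambda>u. (u, y u)) ` ?L = {}" by (auto simp: Cyc_def)
  moreover have "card ((\<lambda>u. (u, y u)) ` ?L) = card ?L" by (rule card_image) (auto simp: inj_on_def)
  ultimately show "inversions_in ?W y = strict_inv y + 2 * n"
    using L fin \<open>finite (Inv y - Cyc y)\<close> by (simp add: inversions_in_def strict_inv_def card_Un_disjoint)
qed

lemma fpf_inj: "fpf y \<Longrightarrow> inj y"
  by (metis fpf_def injI)

lemma fpfD: "fpf y \<Longrightarrow> y (y u) = u" "fpf y \<Longrightarrow> y u \<noteq> u"
  by (auto simp: fpf_def)

lemma fpf_eq_iff: "fpf y \<Longrightarrow> y u = v \<longleftrightarrow> u = y v"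
  by (auto simp: fpf_def)

text \<open>
  Write \<open>t\<close> for the transposition.  Passing from \<open>y\<close> to \<open>y t\<close> is covered by the count above.  The second
  step, from \<open>t y\<close> (the inverse of \<open>y t\<close>, with as many inversions) to \<open>t y t\<close>, is again a
  multiplication on the right.  The two cardinalities below belong to these two steps.
\<close>

lemma strict_inv_conj_transp:
  assumes y: "y \<in> F_Z" and ab: "a < b" "y a < y b"  and nc: "b \<noteq> y a"
  shows "strict_inv (conj_transp a b y) = strict_inv y + 2
    + 2 * card {e. a < e \<and> e < b \<and> y a < y e \<and> y e < y b}
    + 2 * card {e. a < e \<and> e < b \<and> y a < transpose a b (y e) \<and> transpose a b (y e) < y b}"
proof -
  note fy = F_Z_fpf[OF y]
  obtain n where n: "standard_outside n y" "a \<in> window n" "b \<in> window n" using F_Z_window[OF y] .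
  let ?W = "window n" and ?t = "transpose a b"
  have yW: "y u \<in> ?W \<longleftrightarrow> u \<in> ?W" for u using standard_outside_maps[OF fy n(1)] .
  have tW: "?t u \<in> ?W \<longleftrightarrow> u \<in> ?W" for u using n by (auto simp: transpose_def)
  have fin: "finite ?W" by (simp add: window_def)
  have between: "{e \<in> ?W. a < e \<and> e < b \<and> P e} = {e. a < e \<and> e < b \<and> P e}" for P
    using n by (auto simp: window_def)
  have oth: "?t (y a) = y a" "?t (y b) = y b"
    using fy nc ab by (auto simp: fpf_def transpose_def)
  have "inversions_in ?W (conj_transp a b y) = inversions_in ?W ((?t \<circ> y) \<circ> ?t)"
    by (simp add: conj_transp_def)
  also have "\<dots> = inversions_in ?W (?t \<circ> y) + 1
      + 2 * card {e. a < e \<and> e < b \<and> y a < ?t (y e) \<and> ?t (y e) < y b}"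
    using inversions_in_transpose[OF fin n(2,3) ab(1), of "?t \<circ> y"] oth ab(2) fpf_inj[OF fy]
    by (simp add: between inj_compose)
  also have "inversions_in ?W (?t \<circ> y) = inversions_in ?W (y \<circ> ?t)"
    by (rule inversions_in_inverse) (use fy yW tW in \<open>auto simp: fpf_def\<close>)
  also have "\<dots> = inversions_in ?W y + 1 + 2 * card {e. a < e \<and> e < b \<and> y a < y e \<and> y e < y b}"
    using inversions_in_transpose[OF fin n(2,3) ab(1), of y] ab(2) fpf_inj[OF fy]
    by (simp add: between)
  finally show ?thesis
    using strict_inv_window(1)[OF fy n(1)]
      strict_inv_window(1)[OF fpf_conj_transp[OF fy] standard_outside_conj_transp[OF n]]
    by simp
qed

section \<open>Covers in the Bruhat order\<close>

text \<open>
  The criterion for \<open>y\<close> to be covered by its conjugate under the transposition of \<open>a < b\<close>.  The first two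
  conditions are those of the ordinary Bruhat order.  The last two exclude that the cycles through
  \<open>a\<close> and \<open>b\<close> lie side by side with \<open>a\<close>, \<open>b\<close> both right ends or both left ends: the conjugation then turns
  two side by side cycles into two nested ones, and the crossing pair of cycles lies in between.
\<close>

definition cover_pair :: "(int \<Rightarrow> int) \<Rightarrow> int \<Rightarrow> int \<Rightarrow> bool" where
  "cover_pair y a b \<longleftrightarrow> y a < y b \<and> (\<forall>e. a < e \<and> e < b \<longrightarrow> \<not> (y a < y e \<and> y e < y b))
     \<and> \<not> (y a < a \<and> a < y b \<and> y b < b) \<and> \<not> (a < y a \<and> y a < b \<and> b < y b)"

lemma conj_transp_at:
  assumes "fpf y" "y a \<noteq> b"
  shows "conj_transp a b y a = y b" "conj_transp a b y b = y a"
    "conj_transp a b y (y a) = b" "conj_transp a b y (y b) = a"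
  using assms by (auto simp: fpf_def conj_transp_apply transpose_def)

lemma conj_transp_other:
  assumes "fpf y" "u \<noteq> a" "u \<noteq> b" "u \<noteq> y a" "u \<noteq> y b"
  shows "conj_transp a b y u = y u"
  using assms by (auto simp: fpf_def conj_transp_apply transpose_def)

lemma conj_transp_partner: "fpf y \<Longrightarrow> conj_transp a (y a) y = y"
  by (auto simp: fpf_def conj_transp_apply transpose_def fun_eq_iff) metis

lemma strict_inv_conj_transp_less:
  assumes "y \<in> F_Z" "a < b" "y a < y b" "b \<noteq> y a"
  shows "strict_inv y + 2 \<le> strict_inv (conj_transp a b y)"
  using strict_inv_conj_transp[OF assms] by simp

lemma strict_inv_conj_transp_greater:
  assumes "y \<in> F_Z" "a < b" "y b < y a" "b \<noteq> y a"
  shows "strict_inv (conj_transp a b y) + 2 \<le> strict_inv y"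
proof -
  have at: "conj_transp a b y a = y b" "conj_transp a b y b = y a"
    using conj_transp_at[OF F_Z_fpf[OF assms(1)], of a b] assms by auto
  moreover have "b \<noteq> y b" using F_Z_fpf[OF assms(1)] by (metis fpf_def)
  ultimately show ?thesis
    using strict_inv_conj_transp_less[of "conj_transp a b y" a b] F_Z_conj_transp[OF assms(1)] assms
    by simp
qed

lemma strict_inv_conj_transp_jump:
  assumes y: "y \<in> F_Z" and less: "strict_inv y < strict_inv (conj_transp a b y)"
  shows "strict_inv y + 2 \<le> strict_inv (conj_transp a b y)"
proof -
  have *: "strict_inv y + 2 \<le> strict_inv (conj_transp a b y)"
    if "a < b" "strict_inv y < strict_inv (conj_transp a b y)" for a b
  proof -
    have "b \<noteq> y a" using that conj_transp_partner[OF F_Z_fpf[OF y], of a] by auto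
    moreover have "y a \<noteq> y b" using that fpf_inj[OF F_Z_fpf[OF y]] by (auto dest: injD)
    ultimately show ?thesis
      using strict_inv_conj_transp_less[OF y that(1)] strict_inv_conj_transp_greater[OF y that(1)] that
      by linarith
  qed
  have "a \<noteq> b" using less by (auto simp: conj_transp_def)
  then show ?thesis using * less by (metis conj_transp_commute linorder_neqE)
qed

text \<open>
  Length difference one means that both cardinalities in \<open>strict_inv_conj_transp\<close> vanish.  The second set
  differs from the first one only in the two points \<open>y a\<close> and \<open>y b\<close>, which account for the two
  excluded patterns.
\<close>

lemma strict_inv_cover_pair:
  assumes y: "y \<in> F_Z" and ab: "a < b"
  shows "strict_inv (conj_transp a b y) = strict_inv y + 2 \<longleftrightarrow> cover_pair y a b"
proof -
  note fy = F_Z_fpf[OF y]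
  consider "b = y a" | "b \<noteq> y a" "y b < y a" | "b \<noteq> y a" "y a < y b"
    using fpf_inj[OF fy] ab by (metis injD less_irrefl linorder_neqE)
  then show ?thesis
  proof cases
    case 1
    then show ?thesis
      using conj_transp_partner[OF fy, of a] fy ab by (auto simp: cover_pair_def fpf_def)
  next
    case 2
    then show ?thesis
      using strict_inv_conj_transp_greater[OF y ab] by (auto simp: cover_pair_def)
  next
    case 3
    let ?A = "{e. a < e \<and> e < b \<and> y a < y e \<and> y e < y b}"
    let ?B = "{e. a < e \<and> e < b \<and> y a < transpose a b (y e) \<and> transpose a b (y e) < y b}"
    have fin: "finite ?A" "finite ?B"
      by (rule finite_subset[of _ "{a..b}"]; auto)+
    have t: "transpose a b (y e) = (if e = y a then b else if e = y b then a else y e)" for e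
      using fy by (auto simp: transpose_def fpf_def)
    have "strict_inv (conj_transp a b y) = strict_inv y + 2 \<longleftrightarrow> ?A = {} \<and> ?B = {}"
      using strict_inv_conj_transp[OF y ab 3(2,1)] fin by auto
    also have "\<dots> \<longleftrightarrow> cover_pair y a b"
    proof
      assume *: "?A = {} \<and> ?B = {}"
      then have 1: "\<not> (y a < y e \<and> y e < y b)" if "a < e" "e < b" for e using that by auto
      have "y a \<notin> ?B" "y b \<notin> ?B" using * by auto
      then show "cover_pair y a b"
        using 1 3 unfolding cover_pair_def t by auto
    next
      assume *: "cover_pair y a b"
      then have "?A = {}" by (auto simp: cover_pair_def)
      moreover have "?B = {}"
        using * 3(2) unfolding t cover_pair_def by auto
      ultimately show "?A = {} \<and> ?B = {}" by simp
    qed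
    finally show ?thesis .
  qed
qed

text \<open>
  Equality or an increase of \<open>strict_inv\<close> by at least \<open>2\<close> is itself a partial order containing the generating
  relations, hence contains the weakest one.  Because of the gap of \<open>2\<close>, no element fits strictly between two
  elements whose \<open>strict_inv\<close> differ by \<open>2\<close>.
\<close>

lemma bruhat_F_strict_inv:
  assumes "(y, z) \<in> bruhat_F"
  shows "y \<in> F_Z \<and> z \<in> F_Z \<and> (y = z \<or> strict_inv y + 2 \<le> strict_inv z)"
proof -
  let ?r = "{(y, z). y \<in> F_Z \<and> z \<in> F_Z \<and> (y = z \<or> strict_inv y + 2 \<le> strict_inv z)}"
  have "partial_order_on F_Z ?r"
    by (auto simp: partial_order_on_def preorder_on_def refl_on_def trans_def antisym_def)
  moreover have "(z, conj_transp i j z) \<in> ?r"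
    if z: "z \<in> F_Z" and "len_FPF z < len_FPF (conj_transp i j z)" "i \<noteq> j" for z i j
    using strict_inv_conj_transp_jump[OF z, of i j] that F_Z_conj_transp
    by (auto simp: len_FPF_def strict_inv_def divide_less_cancel)
  ultimately have "bruhat_F \<subseteq> ?r" unfolding bruhat_F_def by (intro Inter_lower) auto
  then show ?thesis using assms by auto
qed

lemma bruhat_F_trans:
  assumes "(x, y) \<in> bruhat_F" "(y, z) \<in> bruhat_F"
  shows "(x, z) \<in> bruhat_F"
  unfolding bruhat_F_def
proof (rule InterI)
  fix r assume r: "r \<in> {r. partial_order_on F_Z r \<and> (\<forall>z\<in>F_Z. \<forall>i j. i \<noteq> j \<longrightarrow>
    len_FPF z < len_FPF (conj_transp i j z) \<longrightarrow> (z, conj_transp i j z) \<in> r)}"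
  then have "(x, y) \<in> r" "(y, z) \<in> r" using assms unfolding bruhat_F_def by blast+
  then show "(x, z) \<in> r" using r by (blast dest: partial_order_onD(2) transD)
qed

lemma bruhat_F_refl: "y \<in> F_Z \<Longrightarrow> (y, y) \<in> bruhat_F"
  unfolding bruhat_F_def by (auto dest!: partial_order_onD(1) simp: refl_on_def)

lemma bruhat_F_step:
  assumes "y \<in> F_Z" "a < b" "y a < y b" "b \<noteq> y a"
  shows "(y, conj_transp a b y) \<in> bruhat_F"
  using strict_inv_conj_transp_less[OF assms] assms
  unfolding bruhat_F_def by (auto simp: len_FPF_def strict_inv_def divide_less_cancel)

text \<open>
  If the criterion fails, the conjugation by \<open>(a, b)\<close> factors into a chain of length-increasing conjugations:
  three of them, by \<open>(a, e)\<close>, \<open>(e, b)\<close>, \<open>(a, e)\<close>, if some \<open>e\<close> lies in between, and two of them in the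
  excluded patterns, passing through the pair of crossing cycles.
\<close>

lemma not_cover_pair_intermediate:
  assumes y: "y \<in> F_Z" and ab: "a < b" "y a < y b" "b \<noteq> y a" and nc: "\<not> cover_pair y a b"
  shows "\<exists>w\<in>F_Z. w \<noteq> y \<and> w \<noteq> conj_transp a b y \<and> (y, w) \<in> bruhat_F \<and> (w, conj_transp a b y) \<in> bruhat_F"
proof -
  note fy = F_Z_fpf[OF y]
  \<comment> \<open>Two increasing steps followed by a possibly trivial rest put the first step strictly in between.\<close>
  have between: ?thesis if c: "c < d" "y c < y d" "d \<noteq> y c"
    and e: "e < f" "conj_transp c d y e < conj_transp c d y f" "f \<noteq> conj_transp c d y e"
    and z: "(conj_transp e f (conj_transp c d y), conj_transp a b y) \<in> bruhat_F"
  for c d e f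
  proof -
    let ?w = "conj_transp c d y" and ?x = "conj_transp e f (conj_transp c d y)"
    have w: "?w \<in> F_Z" using F_Z_conj_transp[OF y] .
    have "strict_inv y < strict_inv ?w" "strict_inv ?w < strict_inv ?x"
      using strict_inv_conj_transp_less[OF y c] strict_inv_conj_transp_less[OF w e] by auto
    moreover have "strict_inv ?x \<le> strict_inv (conj_transp a b y)"
      using bruhat_F_strict_inv[OF z] by auto
    ultimately show ?thesis
      using bruhat_F_step[OF y c] bruhat_F_trans[OF bruhat_F_step[OF w e] z] w
      by (intro bexI[of _ ?w]) auto
  qed
  have yy: "y (y u) = u" "y u \<noteq> u" for u using fy by (auto simp: fpf_def)
  consider (mid) e where "a < e" "e < b" "y a < y e" "y e < y b"
    | (left) "y a < a" "a < y b" "y b < b" | (right) "a < y a" "y a < b" "b < y b"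
    using nc ab unfolding cover_pair_def by blast
  then show ?thesis
  proof cases
    case mid
    have ne: "e \<noteq> a" "e \<noteq> b" "e \<noteq> y a" "e \<noteq> y b" "y e \<noteq> a" "y e \<noteq> b" "y a \<noteq> b" "y b \<noteq> a" "a \<noteq> b"
      using mid ab yy[of a] yy[of b] yy[of e] by auto
    let ?w = "conj_transp a e y" let ?x = "conj_transp e b ?w"
    have fw: "fpf ?w" and x: "?x \<in> F_Z"
      using fpf_conj_transp[OF fy] F_Z_conj_transp y by blast+
    have w: "?w a = y e" "?w e = y a" "?w b = y b"
      using conj_transp_at[OF fy, of a e] conj_transp_other[OF fy, of b a e] ne yy by metis+
    have x': "?x a = y e" "?x e = y b" "?x b = y a"
      using conj_transp_at[OF fw, of e b] conj_transp_other[OF fw, of a e b] ne w yy by metis+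
    have eq: "conj_transp a e ?x = conj_transp a b y"
      using ne by (simp add: conj_transp_apply fun_eq_iff transpose_triple)
    have "(?x, conj_transp a b y) \<in> bruhat_F"
      using bruhat_F_step[OF x, of a e] x' mid ne yy(2)[of e] eq by auto
    then show ?thesis
      using between[of a e e b] w mid ne ab by auto
  next
    case left
    let ?w = "conj_transp a (y b) y" let ?x = "conj_transp (y a) a ?w"
    have ne: "y a \<noteq> y b" "a \<noteq> b" "y a \<noteq> b" "y b \<noteq> a" using left ab by auto
    have w': "?w a = b" "?w (y a) = y b"
      using conj_transp_at[OF fy, of a "y b"] ne yy by metis+
    have eq: "?x = conj_transp a b y"
    proof
      fix u
      consider "u \<in> {a, b, y a, y b}" | "u \<notin> {a, b, y a, y b}" by blast
      then show "?x u = conj_transp a b y u"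
      proof cases
        case 1
        then show ?thesis
          using ne ne[symmetric] yy yy(2)[symmetric] by (auto simp: conj_transp_apply)
      next
        case 2
        then have "y u \<notin> {a, b, y a, y b}" using yy by (metis insert_iff singletonD insertE)
        with 2 show ?thesis by (simp add: conj_transp_apply)
      qed
    qed
    show ?thesis
      using between[of a "y b" "y a" a] w' left ne yy eq bruhat_F_refl F_Z_conj_transp[OF y] ab by auto
  next
    case right
    let ?w = "conj_transp (y a) b y" let ?x = "conj_transp b (y b) ?w"
    have ne: "y a \<noteq> y b" "a \<noteq> b" "y a \<noteq> b" "y b \<noteq> a" using right ab yy[of a] by auto
    have w': "?w b = a" "?w (y b) = y a"
      using conj_transp_at[OF fy, of "y a" b] ne yy by metis+
    have eq: "?x = conj_transp a b y"
    proof
      fix u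
      consider "u \<in> {a, b, y a, y b}" | "u \<notin> {a, b, y a, y b}" by blast
      then show "?x u = conj_transp a b y u"
      proof cases
        case 1
        then show ?thesis
          using ne ne[symmetric] yy yy(2)[symmetric] by (auto simp: conj_transp_apply)
      next
        case 2
        then have "y u \<notin> {a, b, y a, y b}" using yy by (metis insert_iff singletonD insertE)
        with 2 show ?thesis by (simp add: conj_transp_apply)
      qed
    qed
    show ?thesis
      using between[of "y a" b b "y b"] w' right ne yy eq bruhat_F_refl F_Z_conj_transp[OF y] ab by auto
  qed
qed

lemma covers_F_conj_transp_iff:
  assumes y: "y \<in> F_Z" and ab: "a < b"
  shows "covers_F y (conj_transp a b y) \<longleftrightarrow> cover_pair y a b"
proof
  let ?z = "conj_transp a b y"
  note fy = F_Z_fpf[OF y]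
  assume "covers_F y ?z"
  then have eq: "{y} = {w \<in> F_Z. (y, w) \<in> bruhat_F \<and> (w, ?z) \<in> bruhat_F \<and> w \<noteq> ?z}"
    by (simp add: covers_F_def)
  then have "(y, ?z) \<in> bruhat_F" "y \<noteq> ?z" by auto
  then have less: "strict_inv y < strict_inv ?z" using bruhat_F_strict_inv by force
  then have "b \<noteq> y a" using conj_transp_partner[OF fy] by auto
  moreover have "y a \<noteq> y b" using fpf_inj[OF fy] ab by (auto dest: injD)
  then have "y a < y b"
    using strict_inv_conj_transp_greater[OF y ab] less \<open>b \<noteq> y a\<close> by linarith
  ultimately show "cover_pair y a b"
    using not_cover_pair_intermediate[OF y ab] eq by blast
next
  let ?z = "conj_transp a b y"
  assume c: "cover_pair y a b"
  then have len: "strict_inv ?z = strict_inv y + 2" using strict_inv_cover_pair[OF y ab] by simp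
  have "y a < y b" using c by (simp add: cover_pair_def)
  moreover have "b \<noteq> y a" using len conj_transp_partner[OF F_Z_fpf[OF y], of a] by auto
  ultimately have yz: "(y, ?z) \<in> bruhat_F" using bruhat_F_step[OF y ab] by simp
  have "w = y" if "(y, w) \<in> bruhat_F" "(w, ?z) \<in> bruhat_F" "w \<noteq> ?z" for w
  proof (rule ccontr)
    assume "w \<noteq> y"
    then have "strict_inv y + 2 \<le> strict_inv w" "strict_inv w + 2 \<le> strict_inv ?z"
      using bruhat_F_strict_inv that by blast+
    then show False using len by simp
  qed
  then show "covers_F y ?z"
    using yz y bruhat_F_refl[OF y] len by (auto simp: covers_F_def)
qed

section \<open>The Leibniz rule for covers moving a right end\<close>

text \<open>
  The descents \<open>i\<close> for which conjugation by \<open>s\<^sub>i\<close> lowers the length; the cycle \<open>(i, i + 1)\<close> is an inversion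
  fixed by that conjugation.
\<close>

definition descent :: "(int \<Rightarrow> int) \<Rightarrow> int \<Rightarrow> bool" where
  "descent z i \<longleftrightarrow> z (i + 1) < z i \<and> z i \<noteq> i + 1"

definition up_covers :: "(int \<Rightarrow> int) \<Rightarrow> int \<Rightarrow> int set" where
  "up_covers y q = {j. q < j \<and> cover_pair y q j}"

definition down_covers :: "(int \<Rightarrow> int) \<Rightarrow> int \<Rightarrow> int set" where
  "down_covers y p = {j. j < p \<and> cover_pair y j p}"

abbreviation simple_conj :: "int \<Rightarrow> (int \<Rightarrow> int) \<Rightarrow> int \<Rightarrow> int" where
  "simple_conj i \<equiv> conj_transp i (i + 1)"

lemma step_cases:
  assumes "fpf y"
  obtains (ascent) "y i < y (i + 1)" | (cycle) "y i = i + 1" | (descent) "descent y i"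
proof -
  have "y i \<noteq> y (i + 1)" using injD[OF fpf_inj[OF assms], of i "i + 1"] by auto
  then have "y i < y (i + 1) \<or> y i = i + 1 \<or> descent y i" by (auto simp: descent_def)
  then show ?thesis using that by blast
qed

lemma ascent_not_cycle: "fpf y \<Longrightarrow> y i < y (i + 1) \<Longrightarrow> y i \<noteq> i + 1"
  using fpfD(1)[of y i] by auto

lemma ascent_not_descent: "y i < y (i + 1) \<Longrightarrow> \<not> descent y i"
  by (simp add: descent_def)

lemma cover_pair_adjacent: "y i < y (i + 1) \<Longrightarrow> cover_pair y i (i + 1)"
  by (auto simp: cover_pair_def)

lemma simple_conj_at:
  assumes "fpf y" "y i \<noteq> i + 1"
  shows "simple_conj i y i = y (i + 1)" "simple_conj i y (i + 1) = y i"
  using conj_transp_at[OF assms] by auto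

lemma descent_simple_conj:
  assumes "fpf y" "y i < y (i + 1)" shows "descent (simple_conj i y) i"
  using simple_conj_at[OF assms(1) ascent_not_cycle[OF assms]] assms
  by (auto simp: descent_def fpf_def)

lemma ascent_simple_conj:
  assumes "fpf y" "descent y i" shows "simple_conj i y i < simple_conj i y (i + 1)"
  using simple_conj_at[OF assms(1)] assms by (auto simp: descent_def)

lemma strict_inv_ascent:
  assumes "y \<in> F_Z" "y i < y (i + 1)"
  shows "strict_inv (simple_conj i y) = strict_inv y + 2"
  using strict_inv_cover_pair[OF assms(1), of i "i + 1"] cover_pair_adjacent[OF assms(2)] by simp

lemma strict_inv_descent:
  assumes "y \<in> F_Z" "descent y i"
  shows "strict_inv y = strict_inv (simple_conj i y) + 2"
  using strict_inv_ascent[OF F_Z_conj_transp[OF assms(1)] ascent_simple_conj[OF F_Z_fpf[OF assms(1)] assms(2)]]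
  by simp

lemma conj_transp_partners:
  assumes "fpf y" "b \<noteq> y a" "a \<noteq> b"
  shows "conj_transp (y a) (y b) y = conj_transp a b y"
proof
  fix u
  note yy = fpfD[OF assms(1)]
  have ne: "a \<noteq> y b" "y a \<noteq> b" using assms yy by metis+
  have at: "conj_transp (y a) (y b) y (y a) = b" "conj_transp (y a) (y b) y (y b) = a"
    "conj_transp (y a) (y b) y a = y b" "conj_transp (y a) (y b) y b = y a"
    using conj_transp_at[OF assms(1), of "y a" "y b"] ne(1) assms(3) unfolding yy(1) by simp_all
  consider "u = a" | "u = b" | "u = y a" | "u = y b" | "u \<notin> {a, b, y a, y b}" by blast
  then show "conj_transp (y a) (y b) y u = conj_transp a b y u"
  proof cases
    case 5
    then show ?thesis
      using conj_transp_other[OF assms(1), of u a b] conj_transp_other[OF assms(1), of u "y a" "y b"]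
      unfolding yy(1) by simp
  qed (use at conj_transp_at[OF assms(1), of a b] ne in simp_all)
qed

lemma cover_pair_partners:
  assumes "y \<in> F_Z" "a < b" "y a < y b" "b \<noteq> y a"
  shows "cover_pair y (y a) (y b) \<longleftrightarrow> cover_pair y a b"
  using strict_inv_cover_pair[OF assms(1), of "y a" "y b"] strict_inv_cover_pair[OF assms(1), of a b]
    conj_transp_partners[OF F_Z_fpf[OF assms(1)], of b a] assms by simp

lemma conj_transp_conjugate:
  "conj_transp (transpose i k a) (transpose i k b) (conj_transp i k y) =
    conj_transp i k (conj_transp a b y)"
proof -
  have "transpose (transpose i k a) (transpose i k b) u = transpose i k (transpose a b (transpose i k u))" for u
    by (auto simp: transpose_def)
  then show ?thesis by (simp only: conj_transp_apply fun_eq_iff transpose_involutory simp_thms)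
qed

text \<open>
  If \<open>i\<close> is an ascent of \<open>y\<close> and a descent of a cover \<open>z\<close>, then \<open>z\<close> is the conjugate of \<open>y\<close> by \<open>s\<^sub>i\<close>: this is a
  case of the lifting property of Bruhat orders.  Conjugation by \<open>(q, j)\<close> changes the values at four points
  only, so it suffices to ask which of them \<open>i\<close> and \<open>i + 1\<close> are and to test the cover criterion at
  \<open>i\<close>, \<open>i + 1\<close> and their images.
\<close>

lemma descent_cover_of_ascent:
  assumes y: "fpf y" and asc: "y i < y (i + 1)" and q: "y q < q" "q < j"
    and c: "cover_pair y q j" and d: "descent (conj_transp q j y) i"
  shows "i = q \<and> j = i + 1 \<or> i = y q \<and> j = y (i + 1)"
proof -
  note yy = fpfD[OF y]
  let ?z = "conj_transp q j y"
  have ne: "y q \<noteq> j" using q by auto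
  have z: "?z q = y j" "?z j = y q" "?z (y q) = j" "?z (y j) = q"
    using conj_transp_at[OF y ne] by auto
  have z': "u \<in> {q, j, y q, y j} \<or> ?z u = y u" for u
    using conj_transp_other[OF y, of u q j] by auto
  have lt: "y q < y j" and btw: "\<And>e. q < e \<Longrightarrow> e < j \<Longrightarrow> y e \<le> y q \<or> y j \<le> y e"
    using c by (auto simp: cover_pair_def not_less)
  have btw': "q < y e \<Longrightarrow> y e < j \<Longrightarrow> e \<le> y q \<or> y j \<le> e" for e
    using btw[of "y e"] yy by auto
  have zd: "?z (i + 1) < ?z i" "?z i \<noteq> i + 1" using d by (simp_all add: descent_def)
  show ?thesis
    using z'[of i] z'[of "i + 1"] z zd asc lt q btw[of i] btw[of "i + 1"] btw'[of i] btw'[of "i + 1"]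
      yy(1)[of i] yy(1)[of "i + 1"] yy(1)[of q] yy(1)[of j]
    by (smt (z3) insert_iff singletonD)
qed

text \<open>
  The conjugation can only destroy the cycle \<open>(i, i + 1)\<close> if it meets \<open>{q, j}\<close>.  If a descent at \<open>i\<close> results,
  then the cycles of \<open>q\<close> and \<open>j\<close> lie side by side in a way that the cover criterion rules out.
\<close>

lemma not_descent_cover_of_cycle:
  assumes y: "fpf y" and cyc: "y i = i + 1" and q: "y q < q" "q < j"
    and c: "cover_pair y q j"
  shows "\<not> descent (conj_transp q j y) i"
proof
  assume d: "descent (conj_transp q j y) i"
  note yy = fpfD[OF y]
  let ?z = "conj_transp q j y"
  have ne: "y q \<noteq> j" using q by auto
  have z: "?z q = y j" "?z j = y q" "?z (y q) = j" "?z (y j) = q"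
    using conj_transp_at[OF y ne] by auto
  have z': "u \<in> {q, j, y q, y j} \<or> ?z u = y u" for u
    using conj_transp_other[OF y, of u q j] by auto
  have lt: "y q < y j" and btw: "\<And>e. q < e \<Longrightarrow> e < j \<Longrightarrow> y e \<le> y q \<or> y j \<le> y e"
    and excl: "\<not> (y q < q \<and> q < y j \<and> y j < j)"
    using c by (auto simp: cover_pair_def not_less)
  have i1: "y (i + 1) = i" using cyc yy by metis
  have zd: "?z (i + 1) < ?z i" "?z i \<noteq> i + 1" using d by (auto simp: descent_def)
  show False
    using z'[of i] z'[of "i + 1"] z zd lt q btw[of i] btw[of "i + 1"] excl cyc i1
      yy(1)[of q] yy(1)[of j]
    by (smt (z3) insert_iff singletonD)
qed

text \<open>
  The remaining way for an ascent to disappear, besides becoming a descent, is to turn into a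
  cycle \<open>(i, i + 1)\<close>.  In the two cases that the order relations leave open, this cycle would be the
  inner one of a nested pair made from two side by side cycles.
\<close>

lemma cover_of_ascent_not_cycle:
  assumes y: "fpf y" and asc: "y i < y (i + 1)" and ab: "a < b" and c: "cover_pair y a b"
  shows "conj_transp a b y i \<noteq> i + 1"
proof
  assume d: "conj_transp a b y i = i + 1"
  note yy = fpfD[OF y]
  have lt: "y a < y b" and btw: "\<And>e. a < e \<Longrightarrow> e < b \<Longrightarrow> y e \<le> y a \<or> y b \<le> y e"
    and excl: "\<not> (y a < a \<and> a < y b \<and> y b < b)" "\<not> (a < y a \<and> y a < b \<and> b < y b)"
    using c by (auto simp: cover_pair_def not_less)
  have d': "y (transpose a b i) = transpose a b (i + 1)"
    using d by (metis conj_transp_apply transpose_involutory)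
  consider "i = a" "i + 1 = b" | "i = a" "i + 1 \<noteq> b" | "i = b" | "i \<noteq> a" "i \<noteq> b" "i + 1 = a"
    | "i \<noteq> a" "i \<noteq> b" "i + 1 = b" | "i \<noteq> a" "i \<noteq> b" "i + 1 \<noteq> a" "i + 1 \<noteq> b" by blast
  then show False
  proof cases
    case 1
    then have "y b = a" using d' by simp
    then show False using asc 1 yy(1)[of b] ab by simp
  next
    case 2
    then have "y b = i + 1" using d' ab by simp
    then show False using lt excl yy(2)[of a] 2 ab by auto
  next
    case 3
    then have "y a = i + 1" using d' ab by simp
    then show False using lt asc yy(1)[of a] 3 ab by simp
  next
    case 4
    then have "y i = b" using d' ab by simp
    then show False using lt asc yy(1)[of i] 4 ab by simp
  next
    case 5
    then have "y i = a" using d' ab by simp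
    then show False using lt asc yy(1)[of i] yy(2)[of b] excl 5 ab by auto
  next
    case 6
    then have "y i = i + 1" using d' by simp
    then show False using ascent_not_cycle[OF y asc] by simp
  qed
qed

lemma up_covers_ascent:
  assumes y: "y \<in> F_Z" and asc: "y i < y (i + 1)" and q: "y q < q"
  shows "{j \<in> up_covers y q. descent (conj_transp q j y) i} =
      (if i = q then {i + 1} else if i = y q then {y (i + 1)} else {})"
    and "j \<in> up_covers y q \<Longrightarrow> descent (conj_transp q j y) i \<Longrightarrow> conj_transp q j y = simple_conj i y"
proof -
  note fy = F_Z_fpf[OF y]
  note yy = fpfD[OF fy]
  have 1: "i = q \<and> j = i + 1 \<or> i = y q \<and> j = y (i + 1)"
    if "j \<in> up_covers y q" "descent (conj_transp q j y) i" for j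
    using descent_cover_of_ascent[OF fy asc q] that by (auto simp: up_covers_def)
  have 2: "q + 1 \<in> up_covers y q" if "i = q"
    using cover_pair_adjacent[of y q] asc that by (auto simp: up_covers_def)
  have 3: "y (i + 1) \<in> up_covers y q \<and> conj_transp q (y (i + 1)) y = simple_conj i y" if i: "i = y q"
  proof -
    have "i + 1 \<noteq> y i" using ascent_not_cycle[OF fy asc] by simp
    then show ?thesis
      using cover_pair_partners[OF y _ asc] conj_transp_partners[OF fy, of "i + 1" i]
        cover_pair_adjacent[OF asc] asc i yy(1)[of q] by (auto simp: up_covers_def)
  qed
  show "{j \<in> up_covers y q. descent (conj_transp q j y) i} =
      (if i = q then {i + 1} else if i = y q then {y (i + 1)} else {})"
    using 1 2 3 descent_simple_conj[OF fy asc] yy(2) by (auto split: if_splits)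
  show "conj_transp q j y = simple_conj i y"
    if "j \<in> up_covers y q" "descent (conj_transp q j y) i"
    using 1[OF that] 3 by auto
qed

lemma finite_up_covers:
  assumes y: "y \<in> F_Z" and q: "y q < q" shows "finite (up_covers y q)"
proof -
  obtain n where n: "standard_outside n y" "q \<in> window n" "y q \<in> window n" using F_Z_window[OF y] .
  have "j \<le> 2 * int n + 4" if j: "j \<in> up_covers y q" for j
  proof (rule ccontr)
    assume "\<not> j \<le> 2 * int n + 4"
    then have out: "y j = Theta j" "y (j - 2) = Theta (j - 2)" and big: "j > 2 * int n + 4"
      using n by (auto simp: standard_outside_def window_def)
    \<comment> \<open>Far to the right \<open>j - 2\<close> lies between \<open>q\<close> and \<open>j\<close>, in position and in value.\<close>
    have "Theta j = Theta (j - 2) + 2" using Theta_cases[of j] Theta_cases[of "j - 2"] by auto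
    moreover have "Theta (j - 2) > 2 * int n"
      using Theta_window[of "j - 2" n] big Theta_cases[of "j - 2"] by (auto simp: window_def)
    ultimately have "q < j - 2 \<and> j - 2 < j \<and> y q < y (j - 2) \<and> y (j - 2) < y j"
      using out n big by (auto simp: window_def)
    then show False using j unfolding up_covers_def cover_pair_def by blast
  qed
  then have "up_covers y q \<subseteq> {q..2 * int n + 4}" by (auto simp: up_covers_def)
  then show ?thesis by (rule finite_subset) simp
qed

lemma transpose_Suc_less:
  fixes a b i :: int
  assumes "a < b" "\<not> (a = i \<and> b = i + 1)"
  shows "transpose i (i + 1) a < transpose i (i + 1) b"
  using assms by (auto simp: transpose_def)

text \<open>
  At a descent \<open>i\<close> of \<open>y\<close>, conjugation by \<open>s\<^sub>i\<close> matches the covers of \<open>y\<close> having \<open>i\<close> as a descent with the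
  covers of \<open>s\<^sub>i y s\<^sub>i\<close> that do not have it.  All lengths drop by one, so the cover relation
  is preserved by the length criterion.
\<close>

lemma up_covers_descent_bij:
  assumes y: "y \<in> F_Z" and d: "descent y i" and q: "y q < q"
  defines "s \<equiv> transpose i (i + 1)"
  shows "j \<in> up_covers y q \<and> descent (conj_transp q j y) i \<longleftrightarrow>
    s j \<in> up_covers (simple_conj i y) (s q) \<and> \<not> descent (conj_transp (s q) (s j) (simple_conj i y)) i"
    (is "?L \<longleftrightarrow> ?R")
proof -
  note fy = F_Z_fpf[OF y]
  let ?y = "simple_conj i y"
  have y': "?y \<in> F_Z" using F_Z_conj_transp[OF y] .
  note fy' = F_Z_fpf[OF y']
  have conj: "conj_transp (s q) (s j) ?y = simple_conj i (conj_transp q j y)"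
    unfolding s_def by (rule conj_transp_conjugate)
  let ?z = "conj_transp q j y" let ?u = "simple_conj i ?z"
  have z: "?z \<in> F_Z" and u: "?u \<in> F_Z" using F_Z_conj_transp y by blast+
  note fz = F_Z_fpf[OF z] and fu = F_Z_fpf[OF u]
  have len: "strict_inv y = strict_inv ?y + 2" using strict_inv_descent[OF y d] .
  show ?thesis
  proof
    assume L: ?L
    then have qj: "q < j" "cover_pair y q j" by (auto simp: up_covers_def)
    then have "\<not> (q = i \<and> j = i + 1)" using d by (auto simp: cover_pair_def descent_def)
    then have "s q < s j" unfolding s_def using transpose_Suc_less qj by blast
    moreover have "strict_inv ?u = strict_inv ?y + 2"
      using strict_inv_cover_pair[OF y qj(1)] qj(2) strict_inv_descent[OF z, of i] L len by simp
    ultimately have "s j \<in> up_covers ?y (s q)"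
      using strict_inv_cover_pair[OF y', of "s q" "s j"] conj by (auto simp: up_covers_def)
    moreover have "\<not> descent ?u i" using ascent_simple_conj[OF fz] L ascent_not_descent by blast
    ultimately show ?R using conj by simp
  next
    assume R: ?R
    then have qj: "s q < s j" "cover_pair ?y (s q) (s j)" by (auto simp: up_covers_def)
    have asc': "?y i < ?y (i + 1)" using ascent_simple_conj[OF fy d] .
    have "\<not> (s q = i \<and> s j = i + 1)"
      using R descent_simple_conj[OF fy' asc'] by metis
    then have less: "q < j" using transpose_Suc_less[of "s q" "s j" i] qj by (simp add: s_def)
    have asc: "?u i < ?u (i + 1)"
      using step_cases[OF fu, of i] R cover_of_ascent_not_cycle[OF fy' asc' qj] conj by metis
    have "strict_inv ?z = strict_inv y + 2"
      using strict_inv_cover_pair[OF y' qj(1)] qj(2) strict_inv_ascent[OF u asc] conj len by simp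
    then have "j \<in> up_covers y q"
      using strict_inv_cover_pair[OF y less] less by (auto simp: up_covers_def)
    moreover have "descent ?z i" using descent_simple_conj[OF fu asc] by simp
    ultimately show ?L by simp
  qed
qed

lemma sum_up_covers_ascent:
  fixes g :: "(int \<Rightarrow> int) \<Rightarrow> int"
  assumes "y \<in> F_Z" "y i < y (i + 1)" "y q < q"
  shows "(\<Sum>j | j \<in> up_covers y q \<and> descent (conj_transp q j y) i. g (conj_transp q j y)) =
      of_bool (i \<in> {q, y q}) * g (simple_conj i y)"
proof -
  have "(\<Sum>j | j \<in> up_covers y q \<and> descent (conj_transp q j y) i. g (conj_transp q j y)) =
      (\<Sum>j | j \<in> up_covers y q \<and> descent (conj_transp q j y) i. g (simple_conj i y))"
  proof (rule sum.cong[OF refl])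
    fix j assume "j \<in> {j. j \<in> up_covers y q \<and> descent (conj_transp q j y) i}"
    then show "g (conj_transp q j y) = g (simple_conj i y)"
      using up_covers_ascent(2)[OF assms, of j] by (metis mem_Collect_eq)
  qed
  also have "\<dots> = of_bool (i \<in> {q, y q}) * g (simple_conj i y)"
    unfolding sum_constant up_covers_ascent(1)[OF assms] by auto
  finally show ?thesis .
qed

text \<open>
  The part of the Leibniz rule that concerns the covers moving \<open>q\<close>.  The correction terms come from the single
  cover that conjugation by \<open>s\<^sub>i\<close> itself produces: it is a cover of \<open>y\<close> if \<open>i\<close> is an ascent, and
  it is \<open>y\<close> as a cover of \<open>s\<^sub>i y s\<^sub>i\<close> if \<open>i\<close> is a descent.
\<close>

lemma leibniz_up_covers:
  fixes f :: "(int \<Rightarrow> int) \<Rightarrow> int" and i :: int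
  assumes y: "y \<in> F_Z" and q: "y q < q"
  defines "s \<equiv> transpose i (i + 1)"
  shows "(\<Sum>j | j \<in> up_covers y q \<and> descent (conj_transp q j y) i. f (simple_conj i (conj_transp q j y))) =
    (if descent y i
     then (\<Sum>j\<in>up_covers (simple_conj i y) (s q). f (conj_transp (s q) j (simple_conj i y)))
       - of_bool (i + 1 \<in> {q, y q}) * f y
     else of_bool (y i < y (i + 1) \<and> i \<in> {q, y q}) * f y)"
proof -
  note fy = F_Z_fpf[OF y]
  show ?thesis
  proof (cases rule: step_cases[OF fy, of i])
    case 1
    then show ?thesis
      using sum_up_covers_ascent[OF y 1 q, of "\<lambda>z. f (simple_conj i z)"] ascent_not_descent[OF 1] by simp
  next
    case 2
    then have empty: "{j. j \<in> up_covers y q \<and> descent (conj_transp q j y) i} = {}"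
      using not_descent_cover_of_cycle[OF fy 2 q] by (auto simp: up_covers_def)
    have "\<not> descent y i" using 2 by (simp add: descent_def)
    moreover have "\<not> y i < y (i + 1)" using ascent_not_cycle[OF fy, of i] 2 by blast
    ultimately show ?thesis unfolding empty by simp
  next
    case 3
    let ?y = "simple_conj i y"
    have y': "?y \<in> F_Z" using F_Z_conj_transp[OF y] .
    have yq: "?y (s q) = s (y q)" by (simp add: conj_transp_apply s_def)
    have "\<not> (y q = i \<and> q = i + 1)" using 3 fpfD(1)[OF fy] by (auto simp: descent_def)
    then have q': "?y (s q) < s q" unfolding yq unfolding s_def using transpose_Suc_less[OF q] by blast
    have asc': "?y i < ?y (i + 1)" using ascent_simple_conj[OF fy 3] .
    let ?A = "{j. j \<in> up_covers ?y (s q) \<and> descent (conj_transp (s q) j ?y) i}"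
    let ?B = "{j. j \<in> up_covers ?y (s q) \<and> \<not> descent (conj_transp (s q) j ?y) i}"
    let ?L = "{j. j \<in> up_covers y q \<and> descent (conj_transp q j y) i}"
    have iff: "j \<in> ?L \<longleftrightarrow> s j \<in> ?B" for j
      using up_covers_descent_bij[OF y 3 q, of j] unfolding s_def mem_Collect_eq .
    have ss: "s (s j) = j" for j by (simp add: s_def)
    have L: "(\<Sum>j\<in>?L. f (simple_conj i (conj_transp q j y))) = (\<Sum>j\<in>?B. f (conj_transp (s q) j ?y))"
    proof (rule sum.reindex_bij_witness[where i = s and j = s])
      show "s j \<in> ?L" if "j \<in> ?B" for j using that unfolding iff ss .
      show "f (conj_transp (s q) (s j) ?y) = f (simple_conj i (conj_transp q j y))" for j
        unfolding s_def conj_transp_conjugate ..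
    qed (rule ss, rule iff[THEN iffD1], assumption, rule ss)
    have A: "(\<Sum>j\<in>?A. f (conj_transp (s q) j ?y)) = of_bool (i \<in> {s q, s (y q)}) * f y"
      using sum_up_covers_ascent[OF y' asc' q', of f] yq by simp
    have mem: "(i \<in> {s q, s (y q)}) = (i + 1 \<in> {q, y q})"
      by (auto simp: s_def transpose_def split: if_splits)
    have AB: "(\<Sum>j\<in>up_covers ?y (s q). f (conj_transp (s q) j ?y)) =
        (\<Sum>j\<in>?A. f (conj_transp (s q) j ?y)) + (\<Sum>j\<in>?B. f (conj_transp (s q) j ?y))"
      by (subst sum.union_disjoint[symmetric])
        (use finite_up_covers[OF y' q'] in \<open>auto intro!: sum.cong\<close>)
    show ?thesis unfolding if_P[OF 3] L AB A mem by simp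
  qed
qed

section \<open>Reflection and the Leibniz rule for covers moving a left end\<close>

text \<open>
  Conjugation by \<open>u \<mapsto> 1 - u\<close>, a reflection of the integers that commutes with \<open>\<Theta>\<close>.
\<close>

definition reflect :: "(int \<Rightarrow> int) \<Rightarrow> int \<Rightarrow> int" where
  "reflect y u = 1 - y (1 - u)"

lemma reflect_reflect [simp]: "reflect (reflect y) = y"
  by (simp add: reflect_def fun_eq_iff)

lemma reflect_Theta: "reflect Theta = Theta"
proof
  fix u :: int
  show "reflect Theta u = Theta u"
    using Theta_cases[of u] Theta_cases[of "1 - u"] by (auto simp: reflect_def)
qed

lemma reflect_F_Z:
  assumes "y \<in> F_Z" shows "reflect y \<in> F_Z"
proof -
  obtain w where w: "w \<in> S_Z" "y = inv w \<circ> Theta \<circ> w" using assms by (auto simp: F_Z_def)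
  have bij: "bij w" using w by (simp add: S_Z_def)
  have inv1: "inv w (w u) = u" "w (inv w u) = u" for u
    using bij by (simp_all add: bij_is_inj bij_is_surj surj_f_inv_f)
  have 1: "reflect (inv w) (reflect w u) = u" "reflect w (reflect (inv w) u) = u" for u
    by (simp_all add: reflect_def inv1)
  have bij': "bij (reflect w)" by (rule o_bij[of "reflect (inv w)"]) (simp_all add: fun_eq_iff 1)
  have inv': "inv (reflect w) = reflect (inv w)" by (rule inv_unique_comp) (simp_all add: fun_eq_iff 1)
  have "{u. reflect w u \<noteq> u} = (\<lambda>u. 1 - u) ` {u. w u \<noteq> u}"
  proof (rule set_eqI)
    fix u
    have "u \<in> (\<lambda>u. 1 - u) ` {u. w u \<noteq> u} \<longleftrightarrow> w (1 - u) \<noteq> 1 - u"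
      by (auto intro: rev_image_eqI[of "1 - u"])
    then show "u \<in> {u. reflect w u \<noteq> u} \<longleftrightarrow> u \<in> (\<lambda>u. 1 - u) ` {u. w u \<noteq> u}"
      by (auto simp: reflect_def)
  qed
  then have "reflect w \<in> S_Z" using w bij' by (simp add: S_Z_def)
  moreover have "reflect y = inv (reflect w) \<circ> Theta \<circ> reflect w"
    unfolding inv' by (subst reflect_Theta[symmetric]) (simp add: w(2) reflect_def fun_eq_iff)
  ultimately show ?thesis by (auto simp: F_Z_def)
qed

lemma reflect_conj_transp:
  "reflect (conj_transp a b y) = conj_transp (1 - a) (1 - b) (reflect y)"
proof -
  have "transpose a b (1 - u) = 1 - transpose (1 - a) (1 - b) u" for u
    by (auto simp: transpose_def)
  moreover have "1 - transpose a b u = transpose (1 - a) (1 - b) (1 - u)" for u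
    by (auto simp: transpose_def)
  ultimately show ?thesis by (simp add: reflect_def conj_transp_apply fun_eq_iff)
qed

lemma reflect_simple_conj: "simple_conj (- i) (reflect y) = reflect (simple_conj i y)"
  unfolding reflect_conj_transp by (subst conj_transp_commute) simp

lemma descent_reflect:
  assumes "fpf y" shows "descent (reflect y) (- i) \<longleftrightarrow> descent y i"
  using fpf_eq_iff[OF assms, of i "i + 1"]
  by (auto simp: descent_def reflect_def add.commute[of 1 i])

lemma cover_pair_reflect: "cover_pair (reflect y) (1 - b) (1 - a) \<longleftrightarrow> cover_pair y a b"
proof -
  have "(\<forall>e. 1 - b < e \<and> e < 1 - a \<longrightarrow> \<not> (1 - y b < 1 - y (1 - e) \<and> 1 - y (1 - e) < 1 - y a)) \<longleftrightarrow>
      (\<forall>e. a < e \<and> e < b \<longrightarrow> \<not> (y a < y e \<and> y e < y b))" (is "?L \<longleftrightarrow> ?R")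
  proof
    assume L: ?L show ?R
    proof (intro allI impI)
      fix e assume "a < e \<and> e < b"
      then show "\<not> (y a < y e \<and> y e < y b)" using L[rule_format, of "1 - e"] by auto
    qed
  next
    assume R: ?R show ?L
    proof (intro allI impI)
      fix e assume "1 - b < e \<and> e < 1 - a"
      then show "\<not> (1 - y b < 1 - y (1 - e) \<and> 1 - y (1 - e) < 1 - y a)"
        using R[rule_format, of "1 - e"] by auto
    qed
  qed
  then show ?thesis by (auto simp: cover_pair_def reflect_def)
qed

lemma up_covers_reflect: "j \<in> up_covers (reflect y) (1 - p) \<longleftrightarrow> 1 - j \<in> down_covers y p"
  using cover_pair_reflect[of y p "1 - j"] by (auto simp: up_covers_def down_covers_def)

lemma sum_down_covers_reflect:
  "(\<Sum>j | j \<in> down_covers y p \<and> P (conj_transp j p y). g (conj_transp j p y)) =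
   (\<Sum>j | j \<in> up_covers (reflect y) (1 - p) \<and> P (reflect (conj_transp (1 - p) j (reflect y))).
      g (reflect (conj_transp (1 - p) j (reflect y))))"
  by (rule sum.reindex_bij_witness[where i = "\<lambda>j. 1 - j" and j = "\<lambda>j. 1 - j"])
     (auto simp: up_covers_reflect reflect_conj_transp conj_transp_commute[of p])

lemma finite_down_covers:
  assumes y: "y \<in> F_Z" and p: "p < y p" shows "finite (down_covers y p)"
proof -
  have "finite (up_covers (reflect y) (1 - p))"
    using finite_up_covers[OF reflect_F_Z[OF y], of "1 - p"] p by (simp add: reflect_def)
  moreover have "down_covers y p = (\<lambda>j. 1 - j) ` up_covers (reflect y) (1 - p)"
    by (auto simp: up_covers_reflect intro: rev_image_eqI[of "1 - _"])
  ultimately show ?thesis by simp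
qed

lemma leibniz_down_covers:
  fixes f :: "(int \<Rightarrow> int) \<Rightarrow> int" and i :: int
  assumes y: "y \<in> F_Z" and p: "p < y p"
  defines "s \<equiv> transpose i (i + 1)"
  shows "(\<Sum>j | j \<in> down_covers y p \<and> descent (conj_transp j p y) i. f (simple_conj i (conj_transp j p y))) =
    (if descent y i
     then (\<Sum>j\<in>down_covers (simple_conj i y) (s p). f (conj_transp j (s p) (simple_conj i y)))
       - of_bool (i \<in> {p, y p}) * f y
     else of_bool (y i < y (i + 1) \<and> i + 1 \<in> {p, y p}) * f y)"
proof -
  let ?y = "reflect y"
  have y': "?y \<in> F_Z" using reflect_F_Z[OF y] .
  have p': "?y (1 - p) = 1 - y p" by (simp add: reflect_def)
  have t: "transpose (- i) (- i + 1) (1 - p) = 1 - s p" by (auto simp: s_def transpose_def)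
  have d: "descent (reflect (conj_transp (1 - p) j ?y)) i \<longleftrightarrow> descent (conj_transp (1 - p) j ?y) (- i)" for j
    using descent_reflect[of "reflect (conj_transp (1 - p) j ?y)" i] F_Z_fpf reflect_F_Z F_Z_conj_transp[OF y']
    by simp
  have sc: "simple_conj i (reflect z) = reflect (simple_conj (- i) z)" for z
    using reflect_simple_conj[of i "reflect z"] by (metis reflect_reflect)
  have "(\<Sum>j | j \<in> down_covers y p \<and> descent (conj_transp j p y) i. f (simple_conj i (conj_transp j p y))) =
     (\<Sum>j | j \<in> up_covers ?y (1 - p) \<and> descent (conj_transp (1 - p) j ?y) (- i).
       f (reflect (simple_conj (- i) (conj_transp (1 - p) j ?y))))"
    using sum_down_covers_reflect[where y = y and p = p and P = "\<lambda>z. descent z i" and g = "\<lambda>z. f (simple_conj i z)"]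
    by (simp only: d sc)
  also have "\<dots> = (if descent ?y (- i)
     then (\<Sum>j\<in>up_covers (simple_conj (- i) ?y) (1 - s p). f (reflect (conj_transp (1 - s p) j (simple_conj (- i) ?y))))
       - of_bool (- i + 1 \<in> {1 - p, ?y (1 - p)}) * f (reflect ?y)
     else of_bool (?y (- i) < ?y (- i + 1) \<and> - i \<in> {1 - p, ?y (1 - p)}) * f (reflect ?y))"
    using leibniz_up_covers[OF y', where q = "1 - p" and f = "\<lambda>z. f (reflect z)" and i = "- i"] p unfolding t p' by simp
  also have "(\<Sum>j\<in>up_covers (simple_conj (- i) ?y) (1 - s p). f (reflect (conj_transp (1 - s p) j (simple_conj (- i) ?y)))) =
      (\<Sum>j\<in>down_covers (simple_conj i y) (s p). f (conj_transp j (s p) (simple_conj i y)))"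
    using sum_down_covers_reflect[where y = "simple_conj i y" and p = "s p" and P = "\<lambda>_. True" and g = f]
    unfolding reflect_simple_conj by simp
  also have "descent ?y (- i) = descent y i" using descent_reflect F_Z_fpf[OF y] .
  also have "(- i + 1 \<in> {1 - p, ?y (1 - p)}) = (i \<in> {p, y p})" unfolding p' by auto
  also have "(?y (- i) < ?y (- i + 1) \<and> - i \<in> {1 - p, ?y (1 - p)}) = (y i < y (i + 1) \<and> i + 1 \<in> {p, y p})"
    unfolding p' by (auto simp: reflect_def add.commute)
  finally show ?thesis by simp
qed

section \<open>Balance of covers for functions with the descent recurrence\<close>

lemma finite_descents:
  assumes "y \<in> F_Z" shows "finite {i. descent y i}"
proof -
  obtain n where "standard_outside n y" using F_Z_window[OF assms] .
  then have "finite (Inv y - Cyc y)" using strict_inv_window(2)[OF F_Z_fpf[OF assms]] by blast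
  moreover have "(\<lambda>i. (i, i + 1)) ` {i. descent y i} \<subseteq> Inv y - Cyc y"
    by (auto simp: descent_def Inv_def Cyc_def)
  ultimately have "finite ((\<lambda>i. (i, i + 1)) ` {i. descent y i})" by (rule rev_finite_subset)
  then show ?thesis by (rule finite_imageD) (auto simp: inj_on_def)
qed

text \<open>
  Expand each \<open>R\<close> by the recurrence and sum over the last step \<open>i\<close> first.  By the two Leibniz rules and the
  induction hypothesis for \<open>s\<^sub>i y s\<^sub>i\<close>, the difference of the two sides for a given \<open>i\<close> is \<open>R y\<close> times the
  coefficient \<open>\<partial>\<^sub>i(x\<^sub>p + x\<^sub>q)\<close>.  Summed over \<open>i\<close>, these receive a contribution \<open>1\<close> from each of \<open>i = p\<close> and
  \<open>i = q\<close> and \<open>-1\<close> from each of \<open>i = p - 1\<close> and \<open>i = q - 1\<close>, hence add up to \<open>0\<close>.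
\<close>

theorem sum_up_covers_eq_sum_down_covers:
  fixes R :: "(int \<Rightarrow> int) \<Rightarrow> int"
  assumes rec: "\<And>z. z \<in> F_Z \<Longrightarrow> 0 < strict_inv z \<Longrightarrow> R z = (\<Sum>i | descent z i. R (simple_conj i z))"
  assumes "y \<in> F_Z" "y p = q" "p < q"
  shows "(\<Sum>j\<in>up_covers y q. R (conj_transp q j y)) = (\<Sum>j\<in>down_covers y p. R (conj_transp j p y))"
  using assms(2-)
proof (induction "strict_inv y" arbitrary: y p q rule: less_induct)
  case less
  note y = \<open>y \<in> F_Z\<close>
  note fy = F_Z_fpf[OF y]
  have yq: "y q = p" using less.prems fpfD(1)[OF fy] by metis
  have q: "y q < q" and p: "p < y p" using less.prems yq by auto
  define U where "U = up_covers y q"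
  define D where "D = down_covers y p"
  have fin: "finite U" "finite D"
    using finite_up_covers[OF y q] finite_down_covers[OF y p] by (simp_all add: U_def D_def)
  have zF: "conj_transp a b y \<in> F_Z" for a b using F_Z_conj_transp[OF y] .
  \<comment> \<open>A finite range for \<open>i\<close> that contains all descents occurring and all points where the coefficients
    can be nonzero.\<close>
  define S where "S = (\<Union>j\<in>U. {i. descent (conj_transp q j y) i}) \<union>
    (\<Union>j\<in>D. {i. descent (conj_transp j p y) i}) \<union> {p, q, p - 1, q - 1}"
  have "finite S" using fin finite_descents[OF zF] by (simp add: S_def)
  then have mem: "p \<in> S" "q \<in> S" "p - 1 \<in> S" "q - 1 \<in> S" by (simp_all add: S_def)
  have up: "R (conj_transp q j y) = (\<Sum>i | i \<in> S \<and> descent (conj_transp q j y) i. R (simple_conj i (conj_transp q j y)))"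
    if "j \<in> U" for j
  proof -
    have "strict_inv (conj_transp q j y) = strict_inv y + 2"
      using that strict_inv_cover_pair[OF y] by (simp add: U_def up_covers_def)
    moreover have "{i. i \<in> S \<and> descent (conj_transp q j y) i} = {i. descent (conj_transp q j y) i}"
      using that by (auto simp: S_def)
    ultimately show ?thesis using rec[OF zF] by simp
  qed
  have down: "R (conj_transp j p y) = (\<Sum>i | i \<in> S \<and> descent (conj_transp j p y) i. R (simple_conj i (conj_transp j p y)))"
    if "j \<in> D" for j
  proof -
    have "strict_inv (conj_transp j p y) = strict_inv y + 2"
      using that strict_inv_cover_pair[OF y] by (simp add: D_def down_covers_def)
    moreover have "{i. i \<in> S \<and> descent (conj_transp j p y) i} = {i. descent (conj_transp j p y) i}"
      using that by (auto simp: S_def)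
    ultimately show ?thesis using rec[OF zF] by simp
  qed
  have step: "(\<Sum>j | j \<in> U \<and> descent (conj_transp q j y) i. R (simple_conj i (conj_transp q j y)))
     - (\<Sum>j | j \<in> D \<and> descent (conj_transp j p y) i. R (simple_conj i (conj_transp j p y)))
     = (of_bool (i \<in> {p, q}) - of_bool (i + 1 \<in> {p, q})) * R y" for i
  proof -
    let ?s = "transpose i (i + 1)" and ?y = "simple_conj i y"
    have pq: "{q, y q} = {p, q}" "{p, y p} = {p, q}" using yq less.prems by auto
    note L = leibniz_up_covers[OF y q, where i = i and f = R] leibniz_down_covers[OF y p, where i = i and f = R]
    show ?thesis
    proof (cases rule: step_cases[OF fy, of i])
      case 1
      then show ?thesis
        unfolding U_def D_def L pq using ascent_not_descent[OF 1] by (simp add: algebra_simps)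
    next
      case 2
      then have "i \<in> {p, q} \<longleftrightarrow> i + 1 \<in> {p, q}"
        using yq less.prems fpfD(1)[OF fy] by (metis insert_iff singletonD)
      moreover have "\<not> y i < y (i + 1)" "\<not> descent y i"
        using ascent_not_cycle[OF fy, of i] 2 by (auto simp: descent_def)
      ultimately show ?thesis unfolding U_def D_def L pq by simp
    next
      case 3
      have "\<not> (p = i \<and> q = i + 1)" using 3 less.prems by (auto simp: descent_def)
      then have "?s p < ?s q" using transpose_Suc_less less.prems by blast
      moreover have "?y (?s p) = ?s q" using less.prems by (simp add: conj_transp_apply)
      moreover have "strict_inv ?y < strict_inv y" using strict_inv_descent[OF y 3] by simp
      ultimately have "(\<Sum>j\<in>up_covers ?y (?s q). R (conj_transp (?s q) j ?y)) =
          (\<Sum>j\<in>down_covers ?y (?s p). R (conj_transp j (?s p) ?y))"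
        using less.hyps F_Z_conj_transp[OF y] by blast
      then show ?thesis unfolding U_def D_def L pq using 3 by (simp add: algebra_simps)
    qed
  qed
  have card: "(\<Sum>i\<in>S. of_bool (i \<in> {p, q}) :: int) = 2" "(\<Sum>i\<in>S. of_bool (i + 1 \<in> {p, q}) :: int) = 2"
  proof -
    have "S \<inter> {i. i \<in> {p, q}} = {p, q}" "S \<inter> {i. i + 1 \<in> {p, q}} = {p - 1, q - 1}"
      using mem by auto
    then show "(\<Sum>i\<in>S. of_bool (i \<in> {p, q}) :: int) = 2" "(\<Sum>i\<in>S. of_bool (i + 1 \<in> {p, q}) :: int) = 2"
      using \<open>finite S\<close> \<open>p < q\<close> by (simp_all only: sum_of_bool_eq) simp_all
  qed
  have "(\<Sum>j\<in>U. R (conj_transp q j y)) - (\<Sum>j\<in>D. R (conj_transp j p y)) =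
     (\<Sum>j\<in>U. \<Sum>i | i \<in> S \<and> descent (conj_transp q j y) i. R (simple_conj i (conj_transp q j y)))
     - (\<Sum>j\<in>D. \<Sum>i | i \<in> S \<and> descent (conj_transp j p y) i. R (simple_conj i (conj_transp j p y)))"
    using up down by simp
  also have "\<dots> = (\<Sum>i\<in>S. \<Sum>j | j \<in> U \<and> descent (conj_transp q j y) i. R (simple_conj i (conj_transp q j y)))
     - (\<Sum>i\<in>S. \<Sum>j | j \<in> D \<and> descent (conj_transp j p y) i. R (simple_conj i (conj_transp j p y)))"
    by (rule arg_cong2[of _ _ _ _ "(-)"]; rule sum.swap_restrict[OF _ \<open>finite S\<close>]) (rule fin)+
  also have "\<dots> = (\<Sum>i\<in>S. (of_bool (i \<in> {p, q}) - of_bool (i + 1 \<in> {p, q})) * R y)"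
    unfolding step[symmetric] by (simp add: sum_subtractf)
  also have "\<dots> = 0"
    using card unfolding sum_distrib_right[symmetric] sum_subtractf by simp
  finally show ?case by (simp add: U_def D_def)
qed

section \<open>Reduced words of permutations\<close>

definition word_product :: "(int \<Rightarrow> int) list \<Rightarrow> int \<Rightarrow> int" where
  "word_product a = foldr (\<circ>) a id"

lemma word_product_Nil: "word_product [] = id"
  by (simp add: word_product_def fun_eq_iff)

lemma word_product_snoc: "word_product (a @ [s]) = word_product a \<circ> s"
proof -
  have "foldr (\<circ>) a g = foldr (\<circ>) a id \<circ> g" for g :: "int \<Rightarrow> int"
    by (induction a) (simp_all add: fun_eq_iff)
  from this[of s] show ?thesis by (simp add: word_product_def)
qed

lemma reduced_words_iff:
  "a \<in> reduced_words w \<longleftrightarrow> set a \<subseteq> range simple_refl \<and> word_product a = w \<and> length a = len w"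
  by (simp add: reduced_words_def word_product_def)

lemma S_Z_window:
  assumes "w \<in> S_Z"
  obtains m where "\<And>u. u \<notin> {- m..m} \<Longrightarrow> w u = u" "i \<in> {- m..m}" "i + 1 \<in> {- m..m :: int}"
proof -
  obtain m where m: "\<And>u. m < \<bar>u\<bar> \<Longrightarrow> w u = u" using S_Z_bound[OF assms] by blast
  show ?thesis by (rule that[of "max m (\<bar>i\<bar> + 1)"]) (use m in auto)
qed

lemma S_Z_inj: "w \<in> S_Z \<Longrightarrow> inj w"
  by (simp add: S_Z_def bij_is_inj)

lemma len_window:
  assumes "inj w" and out: "\<And>u. u \<notin> {- m..m} \<Longrightarrow> w u = u"
  shows "len w = inversions_in {- m..m} w"
proof -
  have in': "w u \<in> {- m..m}" if "u \<in> {- m..m}" for u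
    using out[of "w u"] that injD[OF assms(1), of "w u" u] by metis
  have "Inv w \<subseteq> {- m..m} \<times> {- m..m}"
  proof (rule subsetI)
    fix x assume "x \<in> Inv w"
    then obtain u v where x: "x = (u, v)" "u < v" "w v < w u" by (cases x) (auto simp: Inv_def)
    then have "u \<in> {- m..m} \<and> v \<in> {- m..m}"
      using out[of u] out[of v] in'[of u] in'[of v] by (cases "u \<in> {- m..m}"; cases "v \<in> {- m..m}") auto
    then show "x \<in> {- m..m} \<times> {- m..m}" using x by simp
  qed
  then show ?thesis by (simp add: len_def inversions_in_def Int_absorb2)
qed

lemma len_simple_ascent:
  assumes w: "w \<in> S_Z" and asc: "w i < w (i + 1)"
  shows "len (w \<circ> simple_refl i) = len w + 1"
proof -
  obtain m where m: "\<And>u. u \<notin> {- m..m} \<Longrightarrow> w u = u" "i \<in> {- m..m}" "i + 1 \<in> {- m..m}"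
    using S_Z_window[OF w] by blast
  have inj: "inj w" using w by (simp add: S_Z_def bij_is_inj)
  have "len (w \<circ> simple_refl i) = inversions_in {- m..m} (w \<circ> simple_refl i)"
  proof (rule len_window)
    show "inj (w \<circ> simple_refl i)" using inj by (simp add: inj_compose simple_refl_def)
    show "(w \<circ> simple_refl i) u = u" if "u \<notin> {- m..m}" for u
      using that m(1)[OF that] m(2,3) by (auto simp: simple_refl_def transpose_def)
  qed
  also have "\<dots> = inversions_in {- m..m} w + 1
      + 2 * card {e \<in> {- m..m}. i < e \<and> e < i + 1 \<and> w i < w e \<and> w e < w (i + 1)}"
    unfolding simple_refl_def by (rule inversions_in_transpose) (use m asc inj in auto)
  also have "{e \<in> {- m..m}. i < e \<and> e < i + 1 \<and> w i < w e \<and> w e < w (i + 1)} = {}" by auto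
  also have "inversions_in {- m..m} w = len w" by (rule len_window[OF inj m(1), symmetric])
  finally show ?thesis by (simp add: comp_def)
qed

lemma S_Z_simple: "w \<in> S_Z \<Longrightarrow> w \<circ> simple_refl i \<in> S_Z"
  by (simp add: S_Z_transpose simple_refl_def)

lemma simple_refl_simple_refl [simp]: "w \<circ> simple_refl i \<circ> simple_refl i = w"
  by (simp add: fun_eq_iff simple_refl_def)

lemma len_simple_descent:
  assumes "w \<in> S_Z" "w (i + 1) < w i"
  shows "len w = len (w \<circ> simple_refl i) + 1"
  using len_simple_ascent[OF S_Z_simple[OF assms(1)], of i i] assms(2) by (simp add: simple_refl_def comp_assoc)

lemma len_id: "len id = 0"
proof -
  have "Inv id = {}" by (auto simp: Inv_def)
  then show ?thesis by (simp add: len_def)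
qed

lemma len_word_product_le:
  "set a \<subseteq> range simple_refl \<Longrightarrow> word_product a \<in> S_Z \<and> len (word_product a) \<le> length a"
proof (induction a rule: rev_induct)
  case Nil
  have "id \<in> S_Z" by (simp add: S_Z_def)
  then show "word_product [] \<in> S_Z \<and> len (word_product []) \<le> length ([] :: (int \<Rightarrow> int) list)"
    by (simp add: word_product_Nil len_id)
next
  case (snoc s a)
  then obtain i where s: "s = simple_refl i" by auto
  let ?w = "word_product a"
  have w: "?w \<in> S_Z" "len ?w \<le> length a" using snoc by auto
  have "?w i \<noteq> ?w (i + 1)" using S_Z_inj[OF w(1)] by (metis injD less_add_one less_irrefl)
  then have "len (?w \<circ> simple_refl i) \<le> len ?w + 1"
    using len_simple_ascent[OF w(1), of i] len_simple_descent[OF w(1), of i] by linarith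
  then show "word_product (a @ [s]) \<in> S_Z \<and> len (word_product (a @ [s])) \<le> length (a @ [s])"
    using w S_Z_simple[OF w(1)] by (simp add: s word_product_snoc)
qed

text \<open>
  A strictly increasing map of the integers has differences at least as large as those of the identity;
  fixing points far to the left and far to the right leaves no room for larger ones.
\<close>

lemma ascending_eq_id:
  assumes w: "w \<in> S_Z" and asc: "\<And>i. w i < w (i + 1)"
  shows "w = id"
proof
  fix u
  have mono: "w a + (b - a) \<le> w b" if "a \<le> b" for a b
    using that
  proof (induction b rule: int_ge_induct)
    case (step b)
    then show ?case using asc[of b] by linarith
  qed simp
  obtain m where m: "\<And>u. m < \<bar>u\<bar> \<Longrightarrow> w u = u" using S_Z_bound[OF w] by blast
  define k where "k = \<bar>m\<bar> + \<bar>u\<bar> + 1"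
  have "w (- k) = - k" "w k = k" using m[of "- k"] m[of k] by (auto simp: k_def)
  moreover have "- k \<le> u" "u \<le> k" by (auto simp: k_def)
  ultimately show "w u = id u"
    using mono[of "- k" u] mono[of u k] by simp
qed

lemma reduced_word_exists: "w \<in> S_Z \<Longrightarrow> \<exists>a. a \<in> reduced_words w"
proof (induction "len w" arbitrary: w rule: less_induct)
  case less
  show ?case
  proof (cases "\<exists>i. w (i + 1) < w i")
    case True
    then obtain i where i: "w (i + 1) < w i" by blast
    have len: "len w = len (w \<circ> simple_refl i) + 1" using len_simple_descent[OF less.prems i] .
    then obtain a where "a \<in> reduced_words (w \<circ> simple_refl i)"
      using less.hyps S_Z_simple[OF less.prems] by fastforce
    then have "a @ [simple_refl i] \<in> reduced_words w"
      using len by (simp add: reduced_words_iff word_product_snoc)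
    then show ?thesis by blast
  next
    case False
    have "w i < w (i + 1)" for i
    proof -
      have "w i \<noteq> w (i + 1)" using S_Z_inj[OF less.prems] by (metis injD less_add_one less_irrefl)
      then show ?thesis using False by (meson linorder_neqE)
    qed
    then have "w = id" using ascending_eq_id less.prems by blast
    then have "[] \<in> reduced_words w"
      by (simp add: reduced_words_iff word_product_Nil len_id)
    then show ?thesis by blast
  qed
qed

section \<open>Words of fixed-point-free involutions\<close>

definition word_action :: "(int \<Rightarrow> int) list \<Rightarrow> int \<Rightarrow> int" where
  "word_action a = inv (word_product a) \<circ> Theta \<circ> word_product a"

lemma word_action_Nil [simp]: "word_action [] = Theta"
  by (simp add: word_action_def word_product_Nil)

lemma word_action_snoc:
  assumes "set a \<subseteq> range simple_refl"
  shows "word_action (a @ [simple_refl i]) = simple_conj i (word_action a)"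
proof -
  have "bij (word_product a)" using len_word_product_le[OF assms] by (simp add: S_Z_def)
  then show ?thesis
    unfolding word_action_def word_product_snoc
    by (simp add: simple_refl_def inv_comp_transpose conj_transp_def comp_assoc)
qed

lemma strict_inv_Theta: "strict_inv Theta = 0"
proof -
  have "Inv Theta - Cyc Theta = {}"
  proof -
    have "v = Theta u" if "u < v" "Theta v < Theta u" for u v
      using that Theta_cases[of u] Theta_cases[of v] by auto
    then show ?thesis by (auto simp: Inv_def Cyc_def)
  qed
  then show ?thesis unfolding strict_inv_def by (simp only: card.empty)
qed

lemma strict_inv_word_action_le:
  "set a \<subseteq> range simple_refl \<Longrightarrow> word_action a \<in> F_Z \<and> strict_inv (word_action a) \<le> 2 * length a"
proof (induction a rule: rev_induct)
  case Nil
  show "word_action [] \<in> F_Z \<and> strict_inv (word_action []) \<le> 2 * length ([] :: (int \<Rightarrow> int) list)"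
    by (simp add: Theta_in_F_Z strict_inv_Theta)
next
  case (snoc s a)
  then obtain i where s: "s = simple_refl i" by auto
  let ?y = "word_action a"
  have y: "?y \<in> F_Z" "strict_inv ?y \<le> 2 * length a" using snoc by auto
  have "strict_inv (simple_conj i ?y) \<le> strict_inv ?y + 2"
  proof (cases rule: step_cases[OF F_Z_fpf[OF y(1)], of i])
    case 1
    then show ?thesis using strict_inv_ascent[OF y(1)] by simp
  next
    case 2
    then show ?thesis using conj_transp_partner[OF F_Z_fpf[OF y(1)], of i] by simp
  next
    case 3
    then show ?thesis using strict_inv_descent[OF y(1)] by simp
  qed
  then show "word_action (a @ [s]) \<in> F_Z \<and> strict_inv (word_action (a @ [s])) \<le> 2 * length (a @ [s])"
    using y F_Z_conj_transp[OF y(1)] snoc.prems by (simp add: s word_action_snoc)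
qed

text \<open>
  If \<open>z i > i + 1\<close>, then \<open>z\<close> is increasing from \<open>i\<close> to \<open>z i\<close>, as its only possible falls are cycles of
  neighbours, and this contradicts \<open>z (z i) = i\<close>.  So \<open>z\<close> matches neighbours, and the matching that it has far
  to the left propagates to the right.
\<close>

lemma no_descent_eq_Theta:
  assumes z: "z \<in> F_Z" and no: "\<And>i. \<not> descent z i"
  shows "z = Theta"
proof -
  note fz = F_Z_fpf[OF z]
  note zz = fpfD[OF fz]
  have asc: "z i < z (i + 1)" if "z i \<noteq> i + 1" for i
    using step_cases[OF fz, of i] no that by blast
  have le: "z i \<le> i + 1" for i
  proof (rule ccontr)
    assume big: "\<not> z i \<le> i + 1"
    have "z i \<le> z j" if "i \<le> j" "j \<le> z i" for j
      using that
    proof (induction j rule: int_ge_induct)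
      case base
      then show ?case by simp
    next
      case (step j)
      then have j: "z i \<le> z j" by simp
      have "z j \<noteq> j + 1"
      proof
        assume "z j = j + 1"
        then have "z j = z i" using j step.prems by simp
        then have "j = i" using injD[OF fpf_inj[OF fz]] by blast
        then show False using big \<open>z j = j + 1\<close> by simp
      qed
      then show ?case using asc[of j] j by simp
    qed
    from this[of "z i"] show False using big zz(1)[of i] by simp
  qed
  have near: "z i = i - 1 \<or> z i = i + 1" for i
    using le[of i] le[of "z i"] zz[of i] by (metis add_diff_cancel_right' diff_add_cancel
        dual_order.antisym le_add1 linorder_not_less zle_add1_eq_le order_le_less)
  obtain n where n: "standard_outside n z" using F_Z_window[OF z] .
  have "z u = Theta u" if "- 2 * int n \<le> u" for u
    using that
  proof (induction u rule: int_ge_induct)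
    case base
    then show ?case using n by (auto simp: standard_outside_def window_def)
  next
    case (step u)
    show ?case
    proof (cases "even u")
      case True
      then have "z u = u - 1" using step Theta_even by simp
      then have "z (u + 1) \<noteq> u" using zz(1)[of "u + 1"] by auto
      then show ?thesis using near[of "u + 1"] True by (auto simp: Theta_odd)
    next
      case False
      then have "z u = u + 1" using step Theta_odd by simp
      then show ?thesis using zz(1)[of u] False by (simp add: Theta_even)
    qed
  qed
  moreover have "z u = Theta u" if "u < - 2 * int n" for u
    using n that by (auto simp: standard_outside_def window_def)
  ultimately show ?thesis by (metis ext linorder_not_less)
qed

lemma minimal_word_exists:
  "z \<in> F_Z \<Longrightarrow> \<exists>a. set a \<subseteq> range simple_refl \<and> word_action a = z \<and> 2 * length a = strict_inv z"
proof (induction "strict_inv z" arbitrary: z rule: less_induct)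
  case less
  show ?case
  proof (cases "\<exists>i. descent z i")
    case True
    then obtain i where i: "descent z i" by blast
    have len: "strict_inv z = strict_inv (simple_conj i z) + 2" using strict_inv_descent[OF less.prems i] .
    then obtain a where a: "set a \<subseteq> range simple_refl" "word_action a = simple_conj i z"
        "2 * length a = strict_inv (simple_conj i z)"
      using less.hyps[of "simple_conj i z"] F_Z_conj_transp[OF less.prems] by auto
    then show ?thesis
      using len by (intro exI[of _ "a @ [simple_refl i]"]) (simp add: word_action_snoc)
  next
    case False
    then have "z = Theta" using no_descent_eq_Theta less.prems by blast
    then show ?thesis by (intro exI[of _ "[]"]) (simp add: strict_inv_Theta)
  qed
qed

lemma len_conjugator_ge:
  assumes "v \<in> S_Z" "z = inv v \<circ> Theta \<circ> v"
  shows "strict_inv z \<le> 2 * len v"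
proof -
  obtain a where a: "a \<in> reduced_words v" using reduced_word_exists[OF assms(1)] by blast
  then have "word_action a = z" using assms(2) by (simp add: reduced_words_iff word_action_def)
  then show ?thesis using strict_inv_word_action_le[of a] a by (auto simp: reduced_words_iff)
qed

text \<open>
  A letter changes \<open>strict_inv\<close> by at most \<open>2\<close>, so a word leading to \<open>z\<close> has at least \<open>strict_inv z / 2\<close>
  letters, and descending along descents gives one that attains this bound.  Hence the atoms are the conjugators of
  length \<open>strict_inv z / 2\<close>, and their reduced words are the words attaining the bound.
\<close>

lemma words_FPF_eq:
  assumes z: "z \<in> F_Z"
  shows "words_FPF z = {a. set a \<subseteq> range simple_refl \<and> word_action a = z \<and> 2 * length a = strict_inv z}"
proof (intro equalityI subsetI)
  fix a assume "a \<in> words_FPF z"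
  then obtain w where w: "w \<in> atoms_FPF z" "a \<in> reduced_words w" by (auto simp: words_FPF_def)
  then have a: "set a \<subseteq> range simple_refl" "word_action a = z" "length a = len w"
    by (auto simp: reduced_words_iff atoms_FPF_def word_action_def)
  obtain b where b: "set b \<subseteq> range simple_refl" "word_action b = z" "2 * length b = strict_inv z"
    using minimal_word_exists[OF z] by blast
  have "\<forall>v\<in>S_Z. z = inv v \<circ> Theta \<circ> v \<longrightarrow> len w \<le> len v"
    using w(1) unfolding atoms_FPF_def mem_Collect_eq by (elim conjE)
  then have "len w \<le> len (word_product b)"
    using len_word_product_le[OF b(1)] b(2)[symmetric] unfolding word_action_def by blast
  also have "\<dots> \<le> length b" using len_word_product_le[OF b(1)] by simp
  finally have "2 * length a \<le> strict_inv z" using a b by simp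
  moreover have "strict_inv z \<le> 2 * length a" using strict_inv_word_action_le[OF a(1)] a(2) by simp
  ultimately show "a \<in> {a. set a \<subseteq> range simple_refl \<and> word_action a = z \<and> 2 * length a = strict_inv z}"
    using a by simp
next
  fix a assume "a \<in> {a. set a \<subseteq> range simple_refl \<and> word_action a = z \<and> 2 * length a = strict_inv z}"
  then have a: "set a \<subseteq> range simple_refl" "word_action a = z" "2 * length a = strict_inv z" by auto
  let ?w = "word_product a"
  have w: "?w \<in> S_Z" "len ?w \<le> length a" using len_word_product_le[OF a(1)] by auto
  have zw: "z = inv ?w \<circ> Theta \<circ> ?w" using a(2) by (simp add: word_action_def)
  have "len ?w = length a" using len_conjugator_ge[OF w(1) zw] w(2) a(3) by simp
  moreover from this have "len ?w \<le> len v" if "v \<in> S_Z" "z = inv v \<circ> Theta \<circ> v" for v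
    using len_conjugator_ge[OF that] a(3) by simp
  ultimately show "a \<in> words_FPF z"
    unfolding words_FPF_def atoms_FPF_def using reduced_words_iff w zw a by auto
qed

lemma inj_simple_refl: "simple_refl i = simple_refl k \<Longrightarrow> i = k"
proof -
  assume "simple_refl i = simple_refl k"
  then have "simple_refl i i = simple_refl k i" by simp
  then show "i = k" by (auto simp: simple_refl_def transpose_def split: if_splits)
qed

text \<open>
  Sort the words by their last letter \<open>s\<^sub>i\<close>: the word without it is too short for anything but \<open>i\<close> being an
  ascent before and a descent after the last step.
\<close>

lemma words_FPF_rec:
  assumes z: "z \<in> F_Z" and pos: "0 < strict_inv z"
  shows "words_FPF z = (\<Union>i\<in>{i. descent z i}. (\<lambda>a. a @ [simple_refl i]) ` words_FPF (simple_conj i z))"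
proof (intro equalityI subsetI)
  fix a assume "a \<in> words_FPF z"
  then have a: "set a \<subseteq> range simple_refl" "word_action a = z" "2 * length a = strict_inv z"
    by (auto simp: words_FPF_eq[OF z])
  then have "a \<noteq> []" using pos by auto
  then obtain b i where b: "a = b @ [simple_refl i]" "set b \<subseteq> range simple_refl"
    using a(1) by (cases a rule: rev_cases) auto
  let ?u = "word_action b"
  have u: "?u \<in> F_Z" "strict_inv ?u \<le> 2 * length b" using strict_inv_word_action_le[OF b(2)] by auto
  have zu: "z = simple_conj i ?u" using a(2) b word_action_snoc by simp
  have len: "strict_inv ?u + 2 \<le> strict_inv z" using a(3) b(1) u(2) by simp
  have asc: "?u i < ?u (i + 1)"
  proof (cases rule: step_cases[OF F_Z_fpf[OF u(1)], of i])
    case 2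
    then show ?thesis using conj_transp_partner[OF F_Z_fpf[OF u(1)], of i] zu len by simp
  next
    case 3
    then show ?thesis using strict_inv_descent[OF u(1) 3] zu len by simp
  qed
  have "descent z i" using descent_simple_conj[OF F_Z_fpf[OF u(1)] asc] zu by simp
  moreover have "b \<in> words_FPF (simple_conj i z)"
    using strict_inv_ascent[OF u(1) asc] zu b a(3) by (simp add: words_FPF_eq F_Z_conj_transp[OF z] u(1))
  ultimately show "a \<in> (\<Union>i\<in>{i. descent z i}. (\<lambda>a. a @ [simple_refl i]) ` words_FPF (simple_conj i z))"
    using b(1) by blast
next
  fix a assume "a \<in> (\<Union>i\<in>{i. descent z i}. (\<lambda>a. a @ [simple_refl i]) ` words_FPF (simple_conj i z))"
  then obtain i b where i: "descent z i" "a = b @ [simple_refl i]" "b \<in> words_FPF (simple_conj i z)" by blast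
  then show "a \<in> words_FPF z"
    using strict_inv_descent[OF z i(1)]
    by (auto simp: words_FPF_eq z F_Z_conj_transp[OF z] word_action_snoc)
qed

lemma finite_words_FPF: "z \<in> F_Z \<Longrightarrow> finite (words_FPF z)"
proof (induction "strict_inv z" arbitrary: z rule: less_induct)
  case less
  show ?case
  proof (cases "strict_inv z = 0")
    case True
    then have "words_FPF z \<subseteq> {[]}" using words_FPF_eq[OF less.prems] by auto
    then show ?thesis by (rule finite_subset) simp
  next
    case False
    then have "finite (words_FPF (simple_conj i z))" if "descent z i" for i
      using less.hyps F_Z_conj_transp[OF less.prems] strict_inv_descent[OF less.prems that] by simp
    then show ?thesis
      using words_FPF_rec[OF less.prems] False finite_descents[OF less.prems] by simp
  qed
qed

lemma card_words_FPF_rec: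
  assumes z: "z \<in> F_Z" and pos: "0 < strict_inv z"
  shows "card (words_FPF z) = (\<Sum>i | descent z i. card (words_FPF (simple_conj i z)))"
proof -
  let ?A = "\<lambda>i. (\<lambda>a. a @ [simple_refl i]) ` words_FPF (simple_conj i z)"
  have "card (words_FPF z) = (\<Sum>i | descent z i. card (?A i))"
    unfolding words_FPF_rec[OF assms]
    by (rule card_UN_disjoint)
      (use finite_descents[OF z] finite_words_FPF[OF F_Z_conj_transp[OF z]] inj_simple_refl in auto)
  then show ?thesis by (simp add: card_image inj_on_def)
qed

section \<open>Transition identity for numbers of words\<close>

lemma sum_Psi_plus:
  assumes y: "y \<in> F_Z" and q: "y q < q"
  shows "(\<Sum>z\<in>Psi_plus y q. g z) = (\<Sum>j\<in>up_covers y q. g (conj_transp q j y))"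
proof -
  note fy = F_Z_fpf[OF y]
  have eq: "Psi_plus y q = (\<lambda>j. conj_transp q j y) ` up_covers y q"
    using covers_F_conj_transp_iff[OF y] F_Z_conj_transp[OF y]
    by (auto simp: Psi_plus_def up_covers_def)
  have at: "conj_transp q j y q = y j" if "j \<in> up_covers y q" for j
  proof -
    have "y q \<noteq> j" using that q by (simp add: up_covers_def)
    then show ?thesis by (rule conj_transp_at(1)[OF fy])
  qed
  have "inj_on (\<lambda>j. conj_transp q j y) (up_covers y q)"
  proof (rule inj_onI)
    fix j k assume "j \<in> up_covers y q" "k \<in> up_covers y q" "conj_transp q j y = conj_transp q k y"
    then have "y j = y k" using at by metis
    then show "j = k" by (rule injD[OF fpf_inj[OF fy]])
  qed
  then show ?thesis unfolding eq by (simp add: sum.reindex)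
qed

lemma sum_Psi_minus:
  assumes y: "y \<in> F_Z" and p: "p < y p"
  shows "(\<Sum>z\<in>Psi_minus y p. g z) = (\<Sum>j\<in>down_covers y p. g (conj_transp j p y))"
proof -
  note fy = F_Z_fpf[OF y]
  have eq: "Psi_minus y p = (\<lambda>j. conj_transp j p y) ` down_covers y p"
    using covers_F_conj_transp_iff[OF y] F_Z_conj_transp[OF y]
    by (auto simp: Psi_minus_def down_covers_def)
  have at: "conj_transp j p y p = y j" if "j \<in> down_covers y p" for j
  proof -
    have "y p \<noteq> j" using that p by (simp add: down_covers_def)
    then show ?thesis
      unfolding conj_transp_commute[of j p] by (rule conj_transp_at(1)[OF fy])
  qed
  have "inj_on (\<lambda>j. conj_transp j p y) (down_covers y p)"
  proof (rule inj_onI)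
    fix j k assume "j \<in> down_covers y p" "k \<in> down_covers y p" "conj_transp j p y = conj_transp k p y"
    then have "y j = y k" using at by metis
    then show "j = k" by (rule injD[OF fpf_inj[OF fy]])
  qed
  then show ?thesis unfolding eq by (simp add: sum.reindex)
qed

theorem proposition4p20:
  fixes y :: "int \<Rightarrow> int" and p q :: int
  assumes "y \<in> F_Z" and "(p, q) \<in> Cyc y"
  shows "(\<Sum>z\<in>Psi_minus y p. card (words_FPF z)) = (\<Sum>z\<in>Psi_plus y q. card (words_FPF z))"
proof -
  have pq: "y p = q" "y q = p" "p < q"
    using assms fpfD[OF F_Z_fpf[OF assms(1)]] by (auto simp: Cyc_def order_le_less) metis
  have "(\<Sum>j\<in>up_covers y q. int (card (words_FPF (conj_transp q j y)))) =
      (\<Sum>j\<in>down_covers y p. int (card (words_FPF (conj_transp j p y))))"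
    by (rule sum_up_covers_eq_sum_down_covers[OF _ assms(1) pq(1,3)]) (simp add: card_words_FPF_rec)
  then have "(\<Sum>j\<in>up_covers y q. card (words_FPF (conj_transp q j y))) =
      (\<Sum>j\<in>down_covers y p. card (words_FPF (conj_transp j p y)))"
    by (simp flip: of_nat_sum)
  moreover have "y q < q" "p < y p" using pq by simp_all
  ultimately show ?thesis using assms(1) by (simp add: sum_Psi_plus sum_Psi_minus)
qed

end
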